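(* Let $T : G \curvearrowright X$ be a continuous action of a locally compact unimodular amenable topological group $G$ on a compact pseudometric space $(X, p)$ that preserves a regular Borel probability measure $\mu$ on $X$, and let $(F_k)_{k \in \mathbb{N}}$ be a tempered Følner sequence for $G$. Let $H, L : G \to (0, \infty)$ be measurable functions such that $$p(T_g x, T_g y) \leq L(g) \cdot p(x, y)^{H(g)} \qquad (\forall g \in G,\ x \in X,\ y \in X).$$ Suppose that for each $x \in X$, $(C_k(x))_{k \in \mathbb{N}}$ is a sequence of measurable subsets of $X$ containing the point $x$ such that $\mu(C_k(x)) > 0$, and that for $\mu$-almost all $x \in X$ we have $$\lim_{k \to \infty} \frac{m\left( \left\{ g \in F_k : L(g) \cdot \operatorname{diam}(C_k(x))^{H(g)} > \delta \right\} \right)}{m(F_k)} = 0 \qquad (\forall \delta > 0).$$ Then given $f \in C(X)$, for $\mu$-almost all $x \in X$ we have $$\lim_{k \to \infty} \alpha_{C_k(x)}\left( \operatorname{Avg}_{F_k} f \right) = \mathbb{E} f(x),$$ where $\mathbb{E}$ is the projection (conditional expectation) onto the space of $T$-invariant functions in $L^\infty(X, \mu)$.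
   Context: $m$ denotes a (bi-invariant) Haar measure on $G$. A sequence $(F_k)_{k \in \mathbb{N}}$ of compact subsets of $G$ is Følner if $m(F_k)>0$ for all $k$ and $\lim_k \frac{m(gF_k \,\Delta\, F_k)}{m(F_k)} = 0$ for every $g \in G$; it is tempered if there is a constant $c>0$ such that $m\left( \bigcup_{j<k} F_j^{-1} F_k \right) \leq c \, m(F_k)$ for all $k$. The action convention is $T_{gh}=T_gT_h$. For a compact $K \subseteq G$ with $m(K)>0$ and $f \in C(X)$, $\operatorname{Avg}_K f(x) = \frac{1}{m(K)} \int_K f(T_g x) \, \mathrm{d}m(g)$. For a measurable $C \subseteq X$ with $\mu(C)>0$, $\alpha_C(h) = \frac{1}{\mu(C)} \int_C h \, \mathrm{d}\mu$. $\operatorname{diam}(C) = \sup_{x,y \in C} p(x,y)$. *)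

theory Defs
  imports "HOL-Analysis.Analysis" "HOL-Probability.Conditional_Expectation"
begin

section \<open>Groups, Haar measure, Foelner sequences\<close>

text \<open>
  Groups are types of class \<^class>\<open>topological_group_add\<close>, which does not include commutativity:
  \<open>g + h\<close>, \<open>0\<close>, \<open>- g\<close> stand for the product \<open>gh\<close>, the identity and the inverse of \<open>g\<close>.
  The Hausdorff property is not assumed.
\<close>

definition outer_regular_at :: "'a::topological_space measure \<Rightarrow> 'a set \<Rightarrow> bool" where
  "outer_regular_at M A \<longleftrightarrow>
     emeasure M A = (INF U \<in> {U. open U \<and> A \<subseteq> U}. emeasure M U)"

text \<open>
  The condition \<open>K \<in> sets M\<close> is automatic in Hausdorff spaces, where compact sets are closed.
\<close>

definition inner_regular_at :: "'a::topological_space measure \<Rightarrow> 'a set \<Rightarrow> bool" where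
  "inner_regular_at M A \<longleftrightarrow>
     emeasure M A = (SUP K \<in> {K. compact K \<and> K \<in> sets M \<and> K \<subseteq> A}. emeasure M K)"

definition regular_borel_measure :: "'a::topological_space measure \<Rightarrow> bool" where
  "regular_borel_measure M \<longleftrightarrow>
     sets M = sets borel \<and>
     (\<forall>A\<in>sets borel. outer_regular_at M A \<and> inner_regular_at M A)"

definition left_invariant_measure :: "'g::topological_group_add measure \<Rightarrow> bool" where
  "left_invariant_measure m \<longleftrightarrow>
     (\<forall>g. \<forall>A\<in>sets borel. emeasure m ((\<lambda>h. g + h) ` A) = emeasure m A)"

definition right_invariant_measure :: "'g::topological_group_add measure \<Rightarrow> bool" where
  "right_invariant_measure m \<longleftrightarrow>
     (\<forall>g. \<forall>A\<in>sets borel. emeasure m ((\<lambda>h. h + g) ` A) = emeasure m A)"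

definition left_haar_measure :: "'g::topological_group_add measure \<Rightarrow> bool" where
  "left_haar_measure m \<longleftrightarrow>
     sets m = sets borel \<and>
     emeasure m UNIV \<noteq> 0 \<and>
     (\<forall>K. compact K \<longrightarrow> emeasure m K < \<infinity>) \<and>
     (\<forall>A\<in>sets borel. outer_regular_at m A) \<and>
     (\<forall>U. open U \<longrightarrow> inner_regular_at m U) \<and>
     left_invariant_measure m"

definition unimodular_group :: "'g::topological_group_add itself \<Rightarrow> bool" where
  "unimodular_group _ \<longleftrightarrow>
     (\<forall>m :: 'g measure. left_haar_measure m \<longrightarrow> right_invariant_measure m)"

text \<open>
  Amenability: there is a left-invariant mean on the bounded continuous functions.  For locally
  compact groups this is equivalent to the existence of a left-invariant mean on \<open>L\<^sup>\<infinity>\<close>.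
\<close>

definition amenable_group :: "'g::topological_group_add itself \<Rightarrow> bool" where
  "amenable_group _ \<longleftrightarrow>
     (\<exists>\<Lambda> :: ('g \<Rightarrow>\<^sub>C real) \<Rightarrow> real.
        linear \<Lambda> \<and>
        (\<forall>\<phi>. (\<forall>h. 0 \<le> apply_bcontfun \<phi> h) \<longrightarrow> 0 \<le> \<Lambda> \<phi>) \<and>
        \<Lambda> (const_bcontfun 1) = 1 \<and>
        (\<forall>g \<phi> \<psi>. (\<forall>h. apply_bcontfun \<psi> h = apply_bcontfun \<phi> (g + h)) \<longrightarrow> \<Lambda> \<psi> = \<Lambda> \<phi>))"

definition folner_sequence :: "'g::topological_group_add measure \<Rightarrow> (nat \<Rightarrow> 'g set) \<Rightarrow> bool" where
  "folner_sequence m F \<longleftrightarrow>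
     (\<forall>k. compact (F k) \<and> measure m (F k) > 0) \<and>
     (\<forall>g. (\<lambda>k. measure m (sym_diff ((\<lambda>h. g + h) ` F k) (F k)) / measure m (F k))
            \<longlonglongrightarrow> 0)"

definition tempered_sequence :: "'g::topological_group_add measure \<Rightarrow> (nat \<Rightarrow> 'g set) \<Rightarrow> bool" where
  "tempered_sequence m F \<longleftrightarrow>
     (\<exists>c>0. \<forall>k. measure m (\<Union>j<k. {- a + b | a b. a \<in> F j \<and> b \<in> F k}) \<le> c * measure m (F k))"

section \<open>Pseudometric spaces and actions\<close>

definition pseudometric :: "('x \<Rightarrow> 'x \<Rightarrow> real) \<Rightarrow> bool" where
  "pseudometric p \<longleftrightarrow>
     (\<forall>x y. 0 \<le> p x y) \<and> (\<forall>x. p x x = 0) \<and> (\<forall>x y. p x y = p y x) \<and>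
     (\<forall>x y z. p x z \<le> p x y + p y z)"

definition induces_topology :: "('x::topological_space \<Rightarrow> 'x \<Rightarrow> real) \<Rightarrow> bool" where
  "induces_topology p \<longleftrightarrow>
     (\<forall>U. open U \<longleftrightarrow> (\<forall>x\<in>U. \<exists>e>0. \<forall>y. p x y < e \<longrightarrow> y \<in> U))"

text \<open>To be used for nonempty sets on which \<open>p\<close> is bounded.\<close>

definition pdiam :: "('x \<Rightarrow> 'x \<Rightarrow> real) \<Rightarrow> 'x set \<Rightarrow> real" where
  "pdiam p C = (SUP (x, y) \<in> C \<times> C. p x y)"

definition continuous_action ::
    "('g::topological_group_add \<Rightarrow> 'x::topological_space \<Rightarrow> 'x) \<Rightarrow> bool" where
  "continuous_action T \<longleftrightarrow>
     (\<forall>x. T 0 x = x) \<and> (\<forall>g h x. T (g + h) x = T g (T h x)) \<and>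
     continuous_on UNIV (\<lambda>(g, x). T g x)"

definition preserves_measure :: "('g \<Rightarrow> 'x \<Rightarrow> 'x) \<Rightarrow> 'x measure \<Rightarrow> bool" where
  "preserves_measure T \<mu> \<longleftrightarrow>
     (\<forall>g. T g \<in> measurable \<mu> \<mu> \<and> (\<forall>A\<in>sets \<mu>. emeasure \<mu> (T g -` A \<inter> space \<mu>) = emeasure \<mu> A))"

section \<open>Averages\<close>

definition Avg :: "'g measure \<Rightarrow> ('g \<Rightarrow> 'x \<Rightarrow> 'x) \<Rightarrow> 'g set \<Rightarrow> ('x \<Rightarrow> complex) \<Rightarrow> 'x \<Rightarrow> complex" where
  "Avg m T K f x = (1 / measure m K) *\<^sub>R (LINT g:K|m. f (T g x))"

definition alpha :: "'x measure \<Rightarrow> 'x set \<Rightarrow> ('x \<Rightarrow> complex) \<Rightarrow> complex" where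
  "alpha \<mu> C h = (1 / measure \<mu> C) *\<^sub>R (LINT x:C|\<mu>. h x)"

section \<open>Projection onto the invariant functions\<close>

text \<open>
  The \<open>T\<close>-invariant elements of \<open>L\<^sup>\<infinity>\<close> are the classes of functions \<open>h\<close> such that, for every
  \<open>g\<close>, \<open>h \<circ> T g = h\<close> almost everywhere.  They are the functions measurable with respect to the
  sigma-algebra of almost everywhere invariant sets (lemma \<open>measurable_invariant_algebra_iff\<close>),
  so the projection onto them is the conditional expectation given that sigma-algebra.
\<close>

definition invariant_sets :: "('g \<Rightarrow> 'x \<Rightarrow> 'x) \<Rightarrow> 'x measure \<Rightarrow> 'x set set" where
  "invariant_sets T \<mu> = {A \<in> sets \<mu>. \<forall>g. AE x in \<mu>. T g x \<in> A \<longleftrightarrow> x \<in> A}"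

definition invariant_algebra :: "('g \<Rightarrow> 'x \<Rightarrow> 'x) \<Rightarrow> 'x measure \<Rightarrow> 'x measure" where
  "invariant_algebra T \<mu> = sigma (space \<mu>) (invariant_sets T \<mu>)"

text \<open>\<^const>\<open>real_cond_exp\<close> only covers real functions, hence the two parts.\<close>

definition invariant_expectation ::
    "('g \<Rightarrow> 'x \<Rightarrow> 'x) \<Rightarrow> 'x measure \<Rightarrow> ('x \<Rightarrow> complex) \<Rightarrow> 'x \<Rightarrow> complex" where
  "invariant_expectation T \<mu> f x =
     Complex (real_cond_exp \<mu> (invariant_algebra T \<mu>) (\<lambda>y. Re (f y)) x)
             (real_cond_exp \<mu> (invariant_algebra T \<mu>) (\<lambda>y. Im (f y)) x)"

lemma sigma_algebra_invariant_sets: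
  assumes "preserves_measure T \<mu>"
  shows "sigma_algebra (space \<mu>) (invariant_sets T \<mu>)"
proof -
  have T: "T g x \<in> space \<mu>" if "x \<in> space \<mu>" for g x
    using assms that unfolding preserves_measure_def by (meson measurable_space)
  show ?thesis
    unfolding sigma_algebra_iff2
  proof (intro conjI ballI allI impI)
    show "invariant_sets T \<mu> \<subseteq> Pow (space \<mu>)"
      unfolding invariant_sets_def using sets.sets_into_space by blast
    show "{} \<in> invariant_sets T \<mu>"
      unfolding invariant_sets_def by simp
    show "space \<mu> - A \<in> invariant_sets T \<mu>" if A: "A \<in> invariant_sets T \<mu>" for A
      unfolding invariant_sets_def
    proof (intro CollectI conjI allI)
      show "space \<mu> - A \<in> sets \<mu>" using A unfolding invariant_sets_def by auto
      fix g
      have "AE x in \<mu>. T g x \<in> A \<longleftrightarrow> x \<in> A" using A unfolding invariant_sets_def by auto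
      then show "AE x in \<mu>. T g x \<in> space \<mu> - A \<longleftrightarrow> x \<in> space \<mu> - A"
        using AE_space by eventually_elim (auto simp: T)
    qed
    show "(\<Union>i::nat. A i) \<in> invariant_sets T \<mu>" if A: "range A \<subseteq> invariant_sets T \<mu>" for A
      unfolding invariant_sets_def
    proof (intro CollectI conjI allI)
      have "A i \<in> sets \<mu>" for i using A unfolding invariant_sets_def by auto
      then show "(\<Union>i. A i) \<in> sets \<mu>" by auto
      fix g
      have "AE x in \<mu>. T g x \<in> A i \<longleftrightarrow> x \<in> A i" for i
        using A unfolding invariant_sets_def by auto
      then have "AE x in \<mu>. \<forall>i. T g x \<in> A i \<longleftrightarrow> x \<in> A i"
        by (simp add: AE_all_countable)
      then show "AE x in \<mu>. T g x \<in> (\<Union>i. A i) \<longleftrightarrow> x \<in> (\<Union>i. A i)"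
        by eventually_elim auto
    qed
  qed
qed

lemma sets_invariant_algebra:
  assumes "preserves_measure T \<mu>"
  shows "sets (invariant_algebra T \<mu>) = invariant_sets T \<mu>"
  using sigma_algebra.sets_measure_of_eq[OF sigma_algebra_invariant_sets[OF assms]]
  unfolding invariant_algebra_def by simp

lemma space_invariant_algebra: "space (invariant_algebra T \<mu>) = space \<mu>"
  unfolding invariant_algebra_def invariant_sets_def
  by (rule space_measure_of) (use sets.sets_into_space in blast)

lemma subalgebra_invariant_algebra:
  assumes "preserves_measure T \<mu>"
  shows "subalgebra \<mu> (invariant_algebra T \<mu>)"
  unfolding subalgebra_def sets_invariant_algebra[OF assms]
  by (auto simp: space_invariant_algebra invariant_sets_def)

lemma measurable_invariant_algebra_iff:
  fixes h :: "'x \<Rightarrow> real"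
  assumes "preserves_measure T \<mu>"
  shows "h \<in> borel_measurable (invariant_algebra T \<mu>) \<longleftrightarrow>
         h \<in> borel_measurable \<mu> \<and> (\<forall>g. AE x in \<mu>. h (T g x) = h x)"
proof -
  have T: "T g x \<in> space \<mu>" if "x \<in> space \<mu>" for g x
    using assms that unfolding preserves_measure_def by (meson measurable_space)
  show ?thesis
  proof
    assume h: "h \<in> borel_measurable (invariant_algebra T \<mu>)"
    have "AE x in \<mu>. h (T g x) = h x" for g
    proof -
      have "AE x in \<mu>. h (T g x) \<le> real_of_rat q \<longleftrightarrow> h x \<le> real_of_rat q" for q
      proof -
        have "{x \<in> space \<mu>. h x \<le> real_of_rat q} \<in> invariant_sets T \<mu>"
          using h unfolding borel_measurable_iff_le
          by (auto simp: space_invariant_algebra sets_invariant_algebra[OF assms])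
        then have "AE x in \<mu>. T g x \<in> {x \<in> space \<mu>. h x \<le> real_of_rat q} \<longleftrightarrow>
                              x \<in> {x \<in> space \<mu>. h x \<le> real_of_rat q}"
          unfolding invariant_sets_def by blast
        then show ?thesis
          using AE_space by eventually_elim (auto simp: T)
      qed
      then have "AE x in \<mu>. \<forall>q. h (T g x) \<le> real_of_rat q \<longleftrightarrow> h x \<le> real_of_rat q"
        by (simp add: AE_all_countable)
      then show ?thesis
      proof eventually_elim
        case (elim x)
        show ?case
        proof (rule ccontr)
          assume "h (T g x) \<noteq> h x"
          then consider "h (T g x) < h x" | "h x < h (T g x)" by linarith
          then show False
            by cases (use elim of_rat_dense in \<open>meson less_imp_le not_le\<close>)+
        qed
      qed
    qed
    then show "h \<in> borel_measurable \<mu> \<and> (\<forall>g. AE x in \<mu>. h (T g x) = h x)"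
      using measurable_from_subalg[OF subalgebra_invariant_algebra[OF assms] h] by blast
  next
    assume h: "h \<in> borel_measurable \<mu> \<and> (\<forall>g. AE x in \<mu>. h (T g x) = h x)"
    show "h \<in> borel_measurable (invariant_algebra T \<mu>)"
    proof (rule measurableI)
      fix B :: "real set" assume B: "B \<in> sets borel"
      have "AE x in \<mu>. T g x \<in> h -` B \<inter> space \<mu> \<longleftrightarrow> x \<in> h -` B \<inter> space \<mu>" for g
      proof -
        have "AE x in \<mu>. h (T g x) = h x" using h by blast
        then show ?thesis using AE_space by eventually_elim (auto simp: T)
      qed
      moreover have "h -` B \<inter> space \<mu> \<in> sets \<mu>" using h B measurable_sets by blast
      ultimately show "h -` B \<inter> space (invariant_algebra T \<mu>) \<in> sets (invariant_algebra T \<mu>)"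
        unfolding sets_invariant_algebra[OF assms] space_invariant_algebra invariant_sets_def
        by blast
    qed simp
  qed
qed

end

theory Submission
  imports Defs
begin

text \<open>
  By uniform continuity of \<open>f\<close> and the hypothesis on the sets \<open>C\<^sub>k(x)\<close>, the average of
  \<open>Avg f\<close> over \<open>C\<^sub>k(x)\<close> differs from its value at \<open>x\<close> by a null sequence, so
  everything rests on the pointwise ergodic theorem for tempered Foelner sequences.  That follows
  from the mean ergodic theorem and a weak-type maximal inequality.

  The maximal inequality comes from a deterministic fractional covering argument carried out in
  the space \<open>X\<close> itself.  Let \<open>D\<^sub>j\<close> be the disjoint sets of points at which the average over
  \<open>F\<^sub>j\<close> is the first large one.  Going down from the last index, keep in \<open>E\<^sub>j\<close> those points
  of \<open>D\<^sub>j\<close> whose translate \<open>F\<^sub>j x\<close> is met with total weight less than 1 by the translates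
  \<open>F\<^sub>i y\<close> with \<open>i > j\<close> and \<open>y \<in> E\<^sub>i\<close>, each with weight \<open>1 / m(F\<^sub>i)\<close>.  Then every point is
  covered with total weight at most 2, while temperedness bounds the measure of the discarded
  points by \<open>c\<close> times that of the kept ones.  Fubini's
  theorem is used only on \<open>G \<times> X\<close>, where the second factor is second countable.
\<close>

section \<open>Compact sets in topological groups\<close>

text \<open>No open set separates \<open>x\<close> from \<open>x + z\<close>, because
  \<open>z\<close> lies in every neighbourhood of \<open>0\<close>. The sets that do not separate
  them form a sigma-algebra, so induction over the Borel sets applies.\<close>

lemma borel_translate_indistinguishable:
  fixes A :: "'g::topological_group_add set"
  assumes "A \<in> sets borel" and z: "\<And>U. open U \<Longrightarrow> 0 \<in> U \<Longrightarrow> z \<in> U"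
  shows "x + z \<in> A \<longleftrightarrow> x \<in> A"
proof -
  have "A \<in> sigma_sets UNIV (Collect open)"
    using assms(1) by (simp add: borel_def)
  then have "\<forall>x. x + z \<in> A \<longleftrightarrow> x \<in> A"
  proof induction
    case (Basic U)
    then have U: "open U" by simp
    show ?case
    proof (intro allI iffI)
      fix x assume "x + z \<in> U"
      \<comment> \<open>This neighbourhood of \<open>0\<close> contains \<open>z\<close>, and
        \<open>x + z - z = x\<close>.\<close>
      moreover have "open ((\<lambda>y. x + z - y) -` U)"
        by (intro open_vimage U continuous_intros)
      ultimately show "x \<in> U" using z[of "(\<lambda>y. x + z - y) -` U"] by simp
    next
      fix x assume "x \<in> U"
      moreover have "open ((\<lambda>y. x + y) -` U)"
        by (intro open_vimage U continuous_intros)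
      ultimately show "x + z \<in> U" using z[of "(\<lambda>y. x + y) -` U"] by simp
    qed
  qed auto
  then show ?thesis by blast
qed

text \<open>The usual argument that compact sets are closed in Hausdorff spaces: saturation provides
  disjoint neighbourhoods of a point outside \<open>K\<close> and a point of
  \<open>K\<close>.\<close>

lemma compact_saturated_imp_closed:
  fixes K :: "'g::topological_group_add set"
  assumes "compact K"
    and sat: "\<And>x z. x \<in> K \<Longrightarrow> (\<And>U. open U \<Longrightarrow> 0 \<in> U \<Longrightarrow> z \<in> U) \<Longrightarrow> x + z \<in> K"
  shows "closed K"
  unfolding closed_def
proof (subst open_subopen, intro ballI)
  fix x assume x: "x \<in> - K"
  have "\<exists>V. open V \<and> 0 \<in> V \<and> (\<lambda>y. - k + y) -` V \<inter> (\<lambda>y. - x + y) -` V = {}" if k: "k \<in> K" for k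
  proof -
    \<comment> \<open>If \<open>- k + x\<close> were in every neighbourhood of \<open>0\<close>,
      saturation would put \<open>x\<close> into \<open>K\<close>.\<close>
    have "k + (- k + x) \<notin> K" using x by (simp add: add.assoc[symmetric])
    with sat[OF k] obtain U where U: "open U" "0 \<in> U" "- k + x \<notin> U" by blast
    \<comment> \<open>Continuity of subtraction at \<open>(0, 0)\<close> gives \<open>A - B\<close>
      inside \<open>U\<close>. With \<open>V = A \<inter> B\<close>, a common point of
      \<open>k + V\<close> and \<open>x + V\<close> would put \<open>- k + x\<close> into
      \<open>U\<close>.\<close>
    have "open ((\<lambda>(a, b). a - b :: 'g) -` U)"
      unfolding case_prod_beta by (intro open_vimage U continuous_intros)
    moreover have "(0, 0) \<in> (\<lambda>(a, b). a - b :: 'g) -` U" using U by simp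
    ultimately obtain A B where AB: "open A" "open B" "0 \<in> A" "0 \<in> B"
        "A \<times> B \<subseteq> (\<lambda>(a, b). a - b) -` U"
      by (rule open_prod_elim) auto
    have False if y: "- k + y \<in> A \<inter> B" "- x + y \<in> A \<inter> B" for y
    proof -
      have "(- k + y) - (- x + y) \<in> U" using AB(5) y by auto
      also have "(- k + y) - (- x + y) = - k + x"
        by (simp add: diff_conv_add_uminus minus_add add.assoc del: add_uminus_conv_diff)
      finally show False using U(3) by simp
    qed
    then show ?thesis using AB by (intro exI[of _ "A \<inter> B"]) auto
  qed
  then obtain V where V: "\<And>k. k \<in> K \<Longrightarrow> open (V k)" "\<And>k. k \<in> K \<Longrightarrow> 0 \<in> V k"
      "\<And>k. k \<in> K \<Longrightarrow> (\<lambda>y. - k + y) -` V k \<inter> (\<lambda>y. - x + y) -` V k = {}"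
    by metis
  have op: "open ((\<lambda>y. - k + y) -` V k')" if "k' \<in> K" for k k'
    by (intro open_vimage V that continuous_intros)
  have "K \<subseteq> (\<Union>k\<in>K. (\<lambda>y. - k + y) -` V k)" using V(2) by auto
  then obtain K' where K': "K' \<subseteq> K" "finite K'" "K \<subseteq> (\<Union>k\<in>K'. (\<lambda>y. - k + y) -` V k)"
    using compactE_image[OF \<open>compact K\<close>, of K "\<lambda>k. (\<lambda>y. - k + y) -` V k"] op by metis
  \<comment> \<open>Finitely many sets \<open>k + V k\<close> cover \<open>K\<close>; intersecting
    the matching neighbourhoods of \<open>x\<close> misses all of them.\<close>
  let ?W = "\<Inter>k\<in>K'. (\<lambda>y. - x + y) -` V k"
  have "open ?W" using K' op by (intro open_INT) auto
  moreover have "x \<in> ?W" using V(2) K' by auto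
  moreover have "?W \<subseteq> - K"
  proof (intro subsetI ComplI)
    fix y assume y: "y \<in> ?W" "y \<in> K"
    with K'(3) obtain k where k: "k \<in> K'" "y \<in> (\<lambda>y. - k + y) -` V k" by (meson UN_E subsetD)
    have "y \<in> (\<lambda>y. - x + y) -` V k" using y(1) k(1) by (rule INT_D)
    then have "y \<in> (\<lambda>y. - k + y) -` V k \<inter> (\<lambda>y. - x + y) -` V k" using k(2) by (rule IntI[rotated])
    moreover have "k \<in> K" using k(1) K'(1) by (rule subsetD[rotated])
    ultimately show False using V(3)[of k] by (metis empty_iff)
  qed
  ultimately show "\<exists>W. open W \<and> x \<in> W \<and> W \<subseteq> - K" by blast
qed

lemma compact_minus_plus:
  fixes A B :: "'g::topological_group_add set"
  assumes "compact A" "compact B"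
  shows "compact {- a + b | a b. a \<in> A \<and> b \<in> B}"
proof -
  have "compact ((\<lambda>(a, b). - a + b) ` (A \<times> B))"
    unfolding case_prod_beta
    by (intro compact_continuous_image compact_Times assms continuous_intros)
  also have "(\<lambda>(a, b). - a + b) ` (A \<times> B) = {- a + b | a b. a \<in> A \<and> b \<in> B}" by auto
  finally show ?thesis .
qed

text \<open>Without the Hausdorff property, compact sets need not be Borel, but compact Borel sets are
  unions of cosets of the closure of the identity and hence closed.\<close>

lemma closed_minus_plus:
  fixes A B :: "'g::topological_group_add set"
  assumes "compact A" "compact B" "B \<in> sets borel"
  shows "closed {- a + b | a b. a \<in> A \<and> b \<in> B}"
proof (rule compact_saturated_imp_closed[OF compact_minus_plus[OF assms(1,2)]])
  fix x z :: 'g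
  assume "x \<in> {- a + b | a b. a \<in> A \<and> b \<in> B}" and z: "\<And>U. open U \<Longrightarrow> 0 \<in> U \<Longrightarrow> z \<in> U"
  then obtain a b where ab: "x = - a + b" "a \<in> A" "b \<in> B" by blast
  \<comment> \<open>Saturation passes from \<open>B\<close> to the product set because
    \<open>(- a + b) + z = - a + (b + z)\<close>.\<close>
  then have "b + z \<in> B" using borel_translate_indistinguishable[OF assms(3) z] by blast
  then show "x + z \<in> {- a + b | a b. a \<in> A \<and> b \<in> B}"
    using ab by (auto simp: add.assoc)
qed

section \<open>Compact pseudometric spaces\<close>

lemma
  assumes "pseudometric p"
  shows pm_triangle: "p x z \<le> p x y + p y z" and pm_sym: "p x y = p y x" and pm_nonneg: "0 \<le> p x y"
  using assms unfolding pseudometric_def by blast+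

lemma pball_open:
  assumes "pseudometric p" "induces_topology p"
  shows "open {y. p x y < e}"
proof -
  have "\<exists>d>0. \<forall>z. p y z < d \<longrightarrow> p x z < e" if "p x y < e" for y
  proof (intro exI[of _ "e - p x y"] conjI allI impI)
    fix z assume "p y z < e - p x y"
    then show "p x z < e" using pm_triangle[OF assms(1), of x z y] by linarith
  qed (use that in simp)
  then show ?thesis using assms(2) unfolding induces_topology_def by auto
qed

lemma open_pball:
  assumes "induces_topology p" "open U" "x \<in> U"
  shows "\<exists>e>0. \<forall>y. p x y < e \<longrightarrow> y \<in> U"
  using assms unfolding induces_topology_def by blast

text \<open>The radius may vary with the centre, as the Lebesgue-number argument below
  requires.\<close>

lemma finite_pball_cover:
  fixes p :: "'x::topological_space \<Rightarrow> 'x \<Rightarrow> real"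
  assumes "pseudometric p" "induces_topology p" "compact (UNIV :: 'x set)" "\<And>x. e x > 0"
  shows "\<exists>D. finite D \<and> (\<forall>y. \<exists>x\<in>D. p x y < e x)"
proof -
  have "p y y < e y" for y
    using assms(1) assms(4)[of y] unfolding pseudometric_def by simp
  then have "UNIV \<subseteq> (\<Union>x\<in>UNIV. {y. p x y < e x})" by blast
  with assms(3) obtain D where "finite D" "UNIV \<subseteq> (\<Union>x\<in>D. {y. p x y < e x})"
    by (rule compactE_image[OF _ pball_open[OF assms(1,2)]])
  then show ?thesis by (intro exI[of _ D]) auto
qed

lemma pseudometric_bdd:
  fixes p :: "'x::topological_space \<Rightarrow> 'x \<Rightarrow> real"
  assumes "pseudometric p" "induces_topology p" "compact (UNIV :: 'x set)"
  shows "\<exists>b. \<forall>x y. p x y \<le> b"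
proof -
  obtain D where D: "finite D" "\<And>y. \<exists>x\<in>D. p x y < 1"
    using finite_pball_cover[OF assms, of "\<lambda>_. 1"] by auto
  \<comment> \<open>Each point is within 1 of a centre in \<open>D\<close>, and the sum over all
    pairs of centres dominates each single distance.\<close>
  define b where "b = 2 + (\<Sum>z\<in>D\<times>D. p (fst z) (snd z))"
  have "p x y \<le> b" for x y
  proof -
    obtain u v where uv: "u \<in> D" "p u x < 1" "v \<in> D" "p v y < 1" using D by metis
    have "p u v \<le> (\<Sum>z\<in>D\<times>D. p (fst z) (snd z))"
      using member_le_sum[of "(u,v)" "D\<times>D" "\<lambda>z. p (fst z) (snd z)"] uv D assms(1)
      by (auto simp: pm_nonneg)
    moreover have "p x y \<le> p u x + p u v + p v y"
      using pm_triangle[OF assms(1), of x y u] pm_triangle[OF assms(1), of u y v]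
        pm_sym[OF assms(1), of x u] by linarith
    ultimately show ?thesis using uv unfolding b_def by linarith
  qed
  then show ?thesis by blast
qed

text \<open>Lebesgue-number argument: continuity gives a radius \<open>2 * r x\<close> at each
  point, finitely many balls of half that radius cover the space, and the least of their radii
  serves as \<open>d\<close>.\<close>

lemma uniformly_continuous_pseudometric:
  fixes p :: "'x::topological_space \<Rightarrow> 'x \<Rightarrow> real" and f :: "'x \<Rightarrow> 'b::metric_space"
  assumes "pseudometric p" "induces_topology p" "compact (UNIV :: 'x set)"
    and "continuous_on UNIV f" "e > 0"
  shows "\<exists>d>0. \<forall>x y. p x y < d \<longrightarrow> dist (f x) (f y) < e"
proof -
  have "\<exists>r>0. \<forall>y. p x y < 2 * r \<longrightarrow> dist (f x) (f y) < e / 2" for x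
  proof -
    have "open (f -` ball (f x) (e/2))" by (intro open_vimage open_ball assms)
    moreover have "x \<in> f -` ball (f x) (e/2)" using assms by simp
    ultimately have "\<exists>r>0. \<forall>y. p x y < r \<longrightarrow> y \<in> f -` ball (f x) (e/2)"
      by (rule open_pball[OF assms(2)])
    then obtain r where "r > 0" "\<forall>y. p x y < r \<longrightarrow> y \<in> f -` ball (f x) (e/2)" by blast
    then show ?thesis by (intro exI[of _ "r/2"]) simp
  qed
  then obtain r where r: "\<And>x. r x > 0" "\<And>x y. p x y < 2 * r x \<Longrightarrow> dist (f x) (f y) < e / 2"
    by metis
  obtain D where D: "finite D" "\<And>y. \<exists>x\<in>D. p x y < r x"
    using finite_pball_cover[OF assms(1,2,3), of r, OF r(1)] by blast
  then have ne: "D \<noteq> {}" by blast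
  define d where "d = Min (r ` D)"
  have "d > 0" unfolding d_def using D(1) ne r(1) by simp
  moreover have "dist (f x) (f y) < e" if "p x y < d" for x y
  proof -
    obtain z where z: "z \<in> D" "p z x < r z" using D by blast
    have "d \<le> r z" unfolding d_def using D(1) z by simp
    moreover have "p z y \<le> p z x + p x y" using assms(1) unfolding pseudometric_def by blast
    ultimately have "p z x < 2 * r z" "p z y < 2 * r z" using z that r(1)[of z] by linarith+
    then have "dist (f z) (f x) < e / 2" "dist (f z) (f y) < e / 2" using r(2)[of z x] r(2)[of z y] by simp_all
    then show ?thesis using dist_triangle3[of "f x" "f y" "f z"] by linarith
  qed
  ultimately show ?thesis by blast
qed

text \<open>Finite nets of mesh \<open>1 / Suc n\<close>, taken for all \<open>n\<close>, yield
  countably many balls that form a base.\<close>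

lemma countable_base_compact_pseudometric:
  fixes p :: "'x::topological_space \<Rightarrow> 'x \<Rightarrow> real"
  assumes "pseudometric p" "induces_topology p" "compact (UNIV :: 'x set)"
  obtains B :: "'x set set" where "countable B" "\<And>V. V \<in> B \<Longrightarrow> open V"
    "\<And>U x. open U \<Longrightarrow> x \<in> U \<Longrightarrow> \<exists>V\<in>B. x \<in> V \<and> V \<subseteq> U"
proof -
  have "\<exists>D. finite D \<and> (\<forall>y. \<exists>x\<in>D. p x y < 1 / Suc n)" for n :: nat
    by (rule finite_pball_cover[OF assms]) simp
  then obtain D where D: "\<And>n. finite (D n)" "\<And>n y. \<exists>x\<in>D n. p x y < 1 / Suc n" by metis
  define B where "B = (\<Union>n. (\<lambda>x. {y. p x y < 1 / Suc n}) ` D n)"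
  show thesis
  proof
    show "countable B" unfolding B_def using D(1) by (auto intro: countable_finite)
    show "open V" if "V \<in> B" for V
      using that pball_open[OF assms(1,2)] unfolding B_def by auto
    fix U x assume "open U" "x \<in> (U :: 'x set)"
    then obtain e where e: "e > 0" "\<And>y. p x y < e \<Longrightarrow> y \<in> U" using open_pball[OF assms(2)] by blast
    \<comment> \<open>Half of \<open>e\<close>, since distances from \<open>x\<close> are estimated
      through the centre of the ball.\<close>
    obtain n :: nat where n: "1 / Suc n < e / 2"
      using reals_Archimedean[of "e/2"] e by (auto simp: inverse_eq_divide)
    obtain z where z: "z \<in> D n" "p z x < 1 / Suc n" using D(2) by blast
    have "p x y \<le> p z x + p z y" for y
      using pm_triangle[OF assms(1), of x y z] pm_sym[OF assms(1), of x z] by linarith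
    then have "y \<in> U" if "p z y < 1 / Suc n" for y
    proof -
      have "p x y < e" using \<open>p x y \<le> p z x + p z y\<close> z n that by linarith
      then show ?thesis by (rule e(2))
    qed
    then show "\<exists>V\<in>B. x \<in> V \<and> V \<subseteq> U"
      using z unfolding B_def by (intro bexI[of _ "{y. p z y < 1 / Suc n}"]) auto
  qed
qed

text \<open>In general the Borel sigma-algebra of a product is larger than the product of the Borel
  sigma-algebras; one second countable factor is enough for them to agree.\<close>

lemma open_in_sets_pair_borel:
  fixes W :: "('g::topological_space \<times> 'x::topological_space) set"
  assumes "countable B" "\<And>V :: 'x set. V \<in> B \<Longrightarrow> open V"
    "\<And>U x. open U \<Longrightarrow> x \<in> U \<Longrightarrow> \<exists>V\<in>B. x \<in> V \<and> V \<subseteq> U" and "open W"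
  shows "W \<in> sets (borel \<Otimes>\<^sub>M borel)"
proof -
  \<comment> \<open>\<open>A V\<close> is the largest open set whose rectangle over \<open>V\<close>
    stays in \<open>W\<close>. Merging all such sets leaves a union indexed by the countable base
    only.\<close>
  define A where "A V = \<Union>{U. open U \<and> U \<times> V \<subseteq> W}" for V
  have "W = (\<Union>V\<in>B. A V \<times> V)"
  proof (intro equalityI subsetI)
    fix z assume "z \<in> W"
    with \<open>open W\<close> obtain U V where UV: "open U" "open V" "z \<in> U \<times> V" "U \<times> V \<subseteq> W"
      by (rule open_prod_elim)
    then obtain V' where V': "V' \<in> B" "snd z \<in> V'" "V' \<subseteq> V" using assms(3)[of V "snd z"] by auto
    then have "U \<times> V' \<subseteq> W" using UV by blast
    then have "z \<in> A V' \<times> V'" using UV V' unfolding A_def by (cases z) auto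
    then show "z \<in> (\<Union>V\<in>B. A V \<times> V)" using V' by blast
  qed (auto simp: A_def)
  also have "\<dots> \<in> sets (borel \<Otimes>\<^sub>M borel)"
    using assms(1,2) unfolding A_def
    by (intro sets.countable_UN' pair_measureI) (auto intro!: borel_open)
  finally show ?thesis .
qed

text \<open>Preimages of open sets are open in \<open>G \<times> X\<close>, and compactness gives
  \<open>X\<close> the countable base that puts them into the product sigma-algebra.\<close>

lemma measurable_continuous_action:
  fixes T :: "'g::topological_group_add \<Rightarrow> 'x::topological_space \<Rightarrow> 'x"
  assumes "pseudometric (p :: 'x \<Rightarrow> 'x \<Rightarrow> real)" "induces_topology p" "compact (UNIV :: 'x set)" "continuous_action T"
  shows "(\<lambda>(g, x). T g x) \<in> borel \<Otimes>\<^sub>M borel \<rightarrow>\<^sub>M borel"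
proof (rule borel_measurableI)
  fix S :: "'x set" assume "open S"
  then have "open ((\<lambda>(g, x). T g x) -` S)"
    using assms(4) unfolding continuous_action_def by (intro open_vimage) auto
  moreover obtain B :: "'x set set" where B: "countable B" "\<And>V. V \<in> B \<Longrightarrow> open V"
    "\<And>U x. open U \<Longrightarrow> x \<in> U \<Longrightarrow> \<exists>V\<in>B. x \<in> V \<and> V \<subseteq> U"
    by (rule countable_base_compact_pseudometric[OF assms(1-3)]) blast
  ultimately have "(\<lambda>(g, x). T g x) -` S \<in> sets (borel \<Otimes>\<^sub>M borel)"
    by (intro open_in_sets_pair_borel[OF B])
  then show "(\<lambda>(g, x). T g x) -` S \<inter> space (borel \<Otimes>\<^sub>M borel) \<in> sets (borel \<Otimes>\<^sub>M borel)"
    by (simp add: space_pair_measure)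
qed

section \<open>The maximal inequality\<close>

locale pmp_action =
  fixes m :: "'g::topological_group_add measure"
    and T :: "'g \<Rightarrow> 'x::topological_space \<Rightarrow> 'x"
    and \<mu> :: "'x measure"
  assumes sets_m [measurable_cong]: "sets m = sets borel"
    and left_invariant: "left_invariant_measure m"
    and prob_space_\<mu>: "prob_space \<mu>"
    and sets_\<mu> [measurable_cong]: "sets \<mu> = sets borel"
    and measurable_action: "(\<lambda>(g, x). T g x) \<in> borel \<Otimes>\<^sub>M borel \<rightarrow>\<^sub>M borel"
    and T_0 [simp]: "T 0 x = x"
    and T_add: "T (g + h) x = T g (T h x)"
    and preserves: "preserves_measure T \<mu>"
begin

section \<open>Joint measurability, invariant integrals and Fubini on
  \<open>G \<times> X\<close>\<close>

sublocale prob_space \<mu> by (rule prob_space_\<mu>)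

lemma space_m [simp]: "space m = UNIV" and space_\<mu> [simp]: "space \<mu> = UNIV"
  using sets_eq_imp_space_eq[OF sets_m] sets_eq_imp_space_eq[OF sets_\<mu>] by auto

lemma T_minus [simp]: "T (- g) (T g x) = x" "T g (T (- g) x) = x"
  by (simp_all add: T_add[symmetric])

lemma measurable_T [measurable (raw)]:
  assumes "a \<in> N \<rightarrow>\<^sub>M borel" "b \<in> N \<rightarrow>\<^sub>M borel"
  shows "(\<lambda>z. T (a z) (b z)) \<in> N \<rightarrow>\<^sub>M borel"
  using measurable_compose[OF measurable_Pair[OF assms] measurable_action] by simp

lemma measurable_uminus_group [measurable]: "uminus \<in> borel_measurable (borel :: 'g measure)"
  by (intro borel_measurable_continuous_onI continuous_intros)

lemma measurable_plus_group [measurable]: "(+) a \<in> borel_measurable (borel :: 'g measure)"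
  by (intro borel_measurable_continuous_onI continuous_intros)

lemma distr_T: "distr \<mu> \<mu> (T g) = \<mu>"
proof (rule measure_eqI)
  fix A assume "A \<in> sets (distr \<mu> \<mu> (T g))"
  then show "emeasure (distr \<mu> \<mu> (T g)) A = emeasure \<mu> A"
    using preserves unfolding preserves_measure_def by (simp add: emeasure_distr)
qed simp

lemma distr_plus: "distr m m ((+) a) = m"
proof (rule measure_eqI)
  fix A assume "A \<in> sets (distr m m ((+) a))"
  then have A: "A \<in> sets borel" by (simp add: sets_m)
  \<comment> \<open>Left invariance is stated for images but \<open>distr\<close> uses preimages; a
    preimage is an image under the inverse translation.\<close>
  have "(+) a -` A = (+) (- a) ` A"
    by (force simp: image_iff add.assoc[symmetric])
  moreover have "emeasure (distr m m ((+) a)) A = emeasure m ((+) a -` A \<inter> space m)"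
    by (rule emeasure_distr) (use A in \<open>auto simp: sets_m\<close>)
  ultimately show "emeasure (distr m m ((+) a)) A = emeasure m A"
    using left_invariant A unfolding left_invariant_measure_def by simp
qed simp

lemma nn_integral_T:
  "h \<in> borel_measurable borel \<Longrightarrow> (\<integral>\<^sup>+x. h (T g x) \<partial>\<mu>) = (\<integral>\<^sup>+x. h x \<partial>\<mu>)"
  using nn_integral_distr[of "T g" \<mu> \<mu> h] by (simp add: distr_T)

lemma nn_integral_plus:
  "h \<in> borel_measurable borel \<Longrightarrow> (\<integral>\<^sup>+g. h (a + g) \<partial>m) = (\<integral>\<^sup>+g. h g \<partial>m)"
  using nn_integral_distr[of "(+) a" m m h] by (simp add: distr_plus)

text \<open>Fubini's theorem is applied to the finite measure
  \<open>density m (indicator K)\<close>, as \<open>m\<close> itself need not be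
  sigma-finite.\<close>

lemma
  assumes K: "K \<in> sets m" "emeasure m K < \<infinity>"
    and [measurable]: "(\<lambda>(g, x). \<phi> g x) \<in> borel_measurable (m \<Otimes>\<^sub>M \<mu>)"
  shows Fubini_on: "(\<integral>\<^sup>+x. (\<integral>\<^sup>+g. indicator K g * \<phi> g x \<partial>m) \<partial>\<mu>)
      = (\<integral>\<^sup>+g. indicator K g * (\<integral>\<^sup>+x. \<phi> g x \<partial>\<mu>) \<partial>m)"
    and measurable_nn_integral_on: "(\<lambda>x. \<integral>\<^sup>+g. indicator K g * \<phi> g x \<partial>m) \<in> borel_measurable \<mu>"
proof -
  define \<nu> where "\<nu> = density m (indicator K)"
  have [measurable_cong]: "sets \<nu> = sets m" by (simp add: \<nu>_def)
  have \<nu>: "(\<integral>\<^sup>+g. h g \<partial>\<nu>) = (\<integral>\<^sup>+g. indicator K g * h g \<partial>m)" if "h \<in> borel_measurable m" for h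
    unfolding \<nu>_def by (rule nn_integral_density) (use K that in auto)
  interpret \<nu>: finite_measure \<nu>
    by (rule finite_measureI) (use K in \<open>simp add: \<nu>_def emeasure_density\<close>)
  interpret P: pair_sigma_finite \<nu> \<mu> ..
  have slice: "(\<lambda>g. \<phi> g x) \<in> borel_measurable m" for x
    by measurable
  have "(\<lambda>x. \<integral>\<^sup>+g. \<phi> g x \<partial>\<nu>) \<in> borel_measurable \<mu>"
    by (rule \<nu>.borel_measurable_nn_integral) measurable
  then show "(\<lambda>x. \<integral>\<^sup>+g. indicator K g * \<phi> g x \<partial>m) \<in> borel_measurable \<mu>"
    by (simp add: \<nu> slice)
  have "(\<integral>\<^sup>+x. (\<integral>\<^sup>+g. \<phi> g x \<partial>\<nu>) \<partial>\<mu>) = (\<integral>\<^sup>+g. (\<integral>\<^sup>+x. \<phi> g x \<partial>\<mu>) \<partial>\<nu>)"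
    using P.Fubini[of "\<lambda>(g, x). \<phi> g x"] by simp
  then show "(\<integral>\<^sup>+x. (\<integral>\<^sup>+g. indicator K g * \<phi> g x \<partial>m) \<partial>\<mu>)
      = (\<integral>\<^sup>+g. indicator K g * (\<integral>\<^sup>+x. \<phi> g x \<partial>\<mu>) \<partial>m)"
    by (simp add: \<nu> slice)
qed

lemma measurable_orbit_integral:
  assumes "K \<in> sets m" "emeasure m K < \<infinity>" and [measurable]: "\<psi> \<in> borel_measurable borel"
  shows "(\<lambda>x. \<integral>\<^sup>+g. indicator K g * \<psi> (T g x) \<partial>m) \<in> borel_measurable \<mu>"
    and "(\<lambda>x. \<integral>\<^sup>+g. indicator K g * \<psi> (T (- g) x) \<partial>m) \<in> borel_measurable \<mu>"
  subgoal by (rule measurable_nn_integral_on[OF assms(1,2)]) measurable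
  subgoal by (rule measurable_nn_integral_on[OF assms(1,2)]) measurable
  done

text \<open>Summing along \<open>K\<close> and along the inverses of \<open>K\<close> are adjoint
  operations: after Fubini, invariance of \<mu> allows \<open>x\<close> to be replaced by
  \<open>T g x\<close> for each fixed \<open>g\<close>. This turns integrals over base points into
  integrals over the points reached by their translates.\<close>

lemma orbit_integral_adjoint:
  assumes K: "K \<in> sets m" "emeasure m K < \<infinity>"
    and [measurable]: "\<phi> \<in> borel_measurable borel" "\<psi> \<in> borel_measurable borel"
  shows "(\<integral>\<^sup>+x. \<phi> x * (\<integral>\<^sup>+g. indicator K g * \<psi> (T (- g) x) \<partial>m) \<partial>\<mu>)
       = (\<integral>\<^sup>+x. \<psi> x * (\<integral>\<^sup>+g. indicator K g * \<phi> (T g x) \<partial>m) \<partial>\<mu>)"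
proof -
  have [measurable]: "K \<in> sets borel" using K(1) by (simp add: sets_m)
  have "(\<integral>\<^sup>+x. \<phi> x * (\<integral>\<^sup>+g. indicator K g * \<psi> (T (- g) x) \<partial>m) \<partial>\<mu>)
      = (\<integral>\<^sup>+x. (\<integral>\<^sup>+g. indicator K g * (\<phi> x * \<psi> (T (- g) x)) \<partial>m) \<partial>\<mu>)"
    by (simp add: nn_integral_cmult[symmetric] mult.left_commute)
  also have "\<dots> = (\<integral>\<^sup>+g. indicator K g * (\<integral>\<^sup>+x. \<phi> x * \<psi> (T (- g) x) \<partial>\<mu>) \<partial>m)"
    by (rule Fubini_on[OF K]) measurable
  also have "\<dots> = (\<integral>\<^sup>+g. indicator K g * (\<integral>\<^sup>+x. \<psi> x * \<phi> (T g x) \<partial>\<mu>) \<partial>m)"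
  proof (rule nn_integral_cong)
    fix g
    have "(\<integral>\<^sup>+x. \<phi> x * \<psi> (T (- g) x) \<partial>\<mu>) = (\<integral>\<^sup>+x. \<psi> x * \<phi> (T g x) \<partial>\<mu>)"
      using nn_integral_T[of "\<lambda>x. \<phi> x * \<psi> (T (- g) x)" g] by (simp add: mult.commute)
    then show "indicator K g * (\<integral>\<^sup>+x. \<phi> x * \<psi> (T (- g) x) \<partial>\<mu>)
        = indicator K g * (\<integral>\<^sup>+x. \<psi> x * \<phi> (T g x) \<partial>\<mu>)" by simp
  qed
  also have "\<dots> = (\<integral>\<^sup>+x. (\<integral>\<^sup>+g. indicator K g * (\<psi> x * \<phi> (T g x)) \<partial>m) \<partial>\<mu>)"
    by (rule Fubini_on[OF K, symmetric]) measurable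
  also have "\<dots> = (\<integral>\<^sup>+x. \<psi> x * (\<integral>\<^sup>+g. indicator K g * \<phi> (T g x) \<partial>m) \<partial>\<mu>)"
    by (simp add: nn_integral_cmult[symmetric] mult.left_commute)
  finally show ?thesis .
qed

end

text \<open>If \<open>T a x = T b y\<close> with \<open>a \<in> F j\<close> and
  \<open>b \<in> F i\<close>, then \<open>y = T (- g) x\<close> for \<open>g = - a + b\<close>. So
  \<open>P j i\<close> collects the group elements relating base points whose translates of stages
  \<open>j\<close> and \<open>i\<close> meet.\<close>

locale tempered_action = pmp_action m T \<mu>
  for m :: "'g::topological_group_add measure"
    and T :: "'g \<Rightarrow> 'x::topological_space \<Rightarrow> 'x"
    and \<mu> :: "'x measure" +
  fixes F :: "nat \<Rightarrow> 'g set" and P :: "nat \<Rightarrow> nat \<Rightarrow> 'g set" and c :: ennreal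
  assumes F_sets [measurable]: "F k \<in> sets m" and F_pos: "0 < emeasure m (F k)"
    and F_finite: "emeasure m (F k) < \<infinity>"
    and P_def: "P j i = {- a + b | a b. a \<in> F j \<and> b \<in> F i}"
    and P_sets [measurable]: "P j i \<in> sets m" and P_finite: "emeasure m (P j i) < \<infinity>"
    and tempered: "emeasure m (\<Union>j<i. P j i) \<le> c * emeasure m (F i)"
begin

section \<open>Greedy selection of translates and the covering bound\<close>

lemma F_sets_borel [measurable]: "F k \<in> sets borel" and P_sets_borel [measurable]: "P j i \<in> sets borel"
  using F_sets P_sets by (simp_all add: sets_m)

text \<open>\<open>load E N j x\<close> is the total weight of the translates already selected at later
  stages that meet the translate of stage \<open>j\<close> based at \<open>x\<close>.\<close>

definition load :: "(nat \<Rightarrow> 'x set) \<Rightarrow> nat \<Rightarrow> nat \<Rightarrow> 'x \<Rightarrow> ennreal" where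
  "load E N j x = (\<Sum>i\<in>{j<..<N}.
     (\<integral>\<^sup>+g. indicator (P j i) g * indicator (E i) (T (- g) x) \<partial>m) / emeasure m (F i))"

lemma measurable_load:
  assumes "\<And>i. j < i \<Longrightarrow> i < N \<Longrightarrow> E i \<in> sets \<mu>"
  shows "load E N j \<in> borel_measurable \<mu>"
proof -
  have "(\<lambda>x. \<integral>\<^sup>+g. indicator (P j i) g * indicator (E i) (T (- g) x) \<partial>m) \<in> borel_measurable \<mu>"
    if "i \<in> {j<..<N}" for i
  proof -
    have [measurable]: "E i \<in> sets borel" using assms that by (simp add: sets_\<mu>)
    show ?thesis by (rule measurable_orbit_integral(2)[OF P_sets P_finite]) measurable
  qed
  then show ?thesis
    unfolding load_def[abs_def] by (intro borel_measurable_sum borel_measurable_divide_ennreal) auto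
qed

text \<open>The load at \<open>j\<close> involves only the sets with larger index, so the sets can
  be built by downward recursion; the induction variable \<open>n\<close> counts the last indices
  already settled.\<close>

lemma greedy_selection:
  assumes D: "\<And>j. D j \<in> sets \<mu>"
  shows "\<exists>E. \<forall>j<N. E j \<in> sets \<mu> \<and> E j = {x \<in> D j. load E N j x < 1}"
proof -
  have "\<exists>E. \<forall>j. N - n \<le> j \<and> j < N \<longrightarrow> E j \<in> sets \<mu> \<and> E j = {x \<in> D j. load E N j x < 1}"
    if "n \<le> N" for n
    using that
  proof (induction n)
    case 0
    then show ?case by auto
  next
    case (Suc n)
    then obtain E where E: "\<And>j. N - n \<le> j \<Longrightarrow> j < N \<Longrightarrow> E j \<in> sets \<mu> \<and> E j = {x \<in> D j. load E N j x < 1}"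
      by auto
    define k where "k = N - Suc n"
    define E' where "E' = E(k := {x \<in> D k. load E N k x < 1})"
    have k: "Suc k = N - n" using Suc.prems unfolding k_def by simp
    \<comment> \<open>Changing the set at \<open>k\<close> alters no load at \<open>k\<close> or
      above, as loads only see strictly later indices.\<close>
    have load: "load E' N j = load E N j" if "k \<le> j" for j
      using that unfolding load_def[abs_def] E'_def by (intro ext sum.cong) auto
    have "E i \<in> sets \<mu>" if "k < i" "i < N" for i using E[of i] that k by linarith
    then have "load E N k \<in> borel_measurable \<mu>" by (intro measurable_load) auto
    then have "{x \<in> space \<mu>. load E N k x < 1} \<in> sets \<mu>" by measurable
    then have "D k \<inter> {x \<in> space \<mu>. load E N k x < 1} \<in> sets \<mu>" using D by blast
    moreover have "D k \<inter> {x \<in> space \<mu>. load E N k x < 1} = {x \<in> D k. load E N k x < 1}" by auto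
    ultimately have k_sets: "E' k \<in> sets \<mu>" unfolding E'_def by simp
    have "E' j \<in> sets \<mu> \<and> E' j = {x \<in> D j. load E' N j x < 1}" if j: "N - Suc n \<le> j" "j < N" for j
    proof (cases "j = k")
      case True
      then show ?thesis using k_sets load[of k] by (simp add: E'_def)
    next
      case False
      then have "N - n \<le> j" using j k unfolding k_def by linarith
      then have "E j \<in> sets \<mu> \<and> E j = {x \<in> D j. load E N j x < 1}" using E j(2) by blast
      moreover have "E' j = E j" "load E' N j = load E N j"
        using False load[of j] j k by (auto simp: E'_def)
      ultimately show ?thesis by metis
    qed
    then show ?case by blast
  qed
  from this[of N] show ?thesis by simp
qed

text \<open>Take the first stage \<open>j\<close> with a selected translate covering
  \<open>y\<close>, and let \<open>T (- h) y\<close> be its base point. Earlier stages contribute 0,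
  stage \<open>j\<close> at most 1, and the later ones at most the load at that base point, which is
  below 1 by selection.\<close>

lemma overlap_le_2:
  assumes E: "\<And>j. j < N \<Longrightarrow> E j \<in> sets \<mu>" "\<And>j x. j < N \<Longrightarrow> x \<in> E j \<Longrightarrow> load E N j x < 1"
  shows "(\<Sum>j<N. (\<integral>\<^sup>+g. indicator (F j) g * indicator (E j) (T (- g) y) \<partial>m) / emeasure m (F j)) \<le> 2"
    (is "(\<Sum>j<N. ?I j / _) \<le> 2")
proof (cases "\<exists>j<N. \<exists>h\<in>F j. T (- h) y \<in> E j")
  case False
  have "?I j = 0" if "j < N" for j
  proof -
    have "indicator (F j) g * indicator (E j) (T (- g) y) = (0 :: ennreal)" for g
      using False that by (auto simp: indicator_def)
    then show ?thesis by (subst nn_integral_cong[where v="\<lambda>_. 0"]) auto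
  qed
  then show ?thesis by simp
next
  case True
  define j where "j = (LEAST j. j < N \<and> (\<exists>h\<in>F j. T (- h) y \<in> E j))"
  from LeastI_ex[OF True] obtain h where j: "j < N" and h: "h \<in> F j" "T (- h) y \<in> E j"
    unfolding j_def by blast
  have zero: "?I i = 0" if "i < j" for i
  proof -
    have "indicator (F i) g * indicator (E i) (T (- g) y) = (0 :: ennreal)" for g
      using not_less_Least[of i "\<lambda>j. j < N \<and> (\<exists>h\<in>F j. T (- h) y \<in> E j)"] \<open>i < j\<close> j
      unfolding j_def[symmetric] by (auto simp: indicator_def)
    then show ?thesis by (subst nn_integral_cong[where v="\<lambda>_. 0"]) auto
  qed
  have "?I j \<le> (\<integral>\<^sup>+g. indicator (F j) g \<partial>m)"
    by (intro nn_integral_mono) (auto simp: indicator_def)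
  then have one: "?I j / emeasure m (F j) \<le> 1"
    using F_pos[of j] F_finite[of j] by (simp add: divide_le_posI_ennreal)
  \<comment> \<open>A translate of stage \<open>i\<close> through \<open>y\<close> meets the one of
    stage \<open>j\<close> based at \<open>T (- h) y\<close>, with \<open>- h + g\<close> in
    \<open>P j i\<close>; left invariance of \<open>m\<close> removes the shift by
    \<open>- h\<close>.\<close>
  have later: "?I i \<le> (\<integral>\<^sup>+g. indicator (P j i) g * indicator (E i) (T (- g) (T (- h) y)) \<partial>m)"
    if i: "i \<in> {j<..<N}" for i
  proof -
    have [measurable]: "E i \<in> sets borel" using E(1) i by (simp add: sets_\<mu>)
    have "?I i \<le> (\<integral>\<^sup>+g. indicator (P j i) (- h + g) * indicator (E i) (T (- (- h + g)) (T (- h) y)) \<partial>m)"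
    proof (intro nn_integral_mono mult_mono)
      fix g
      show "indicator (F i) g \<le> (indicator (P j i) (- h + g) :: ennreal)"
        using h by (auto simp: indicator_def P_def)
      have "T (- (- h + g)) (T (- h) y) = T (- g) y"
        by (simp add: T_add[symmetric] minus_add)
      then show "indicator (E i) (T (- g) y) \<le> (indicator (E i) (T (- (- h + g)) (T (- h) y)) :: ennreal)"
        by simp
    qed auto
    also have "\<dots> = (\<integral>\<^sup>+g. indicator (P j i) g * indicator (E i) (T (- g) (T (- h) y)) \<partial>m)"
      by (rule nn_integral_plus[of "\<lambda>g. indicator (P j i) g * indicator (E i) (T (- g) (T (- h) y))" "- h"])
        measurable
    finally show ?thesis .
  qed
  have split: "sum f {..<N} = sum f {..<j} + (f j + sum f {j<..<N})" for f :: "nat \<Rightarrow> ennreal"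
  proof -
    have "{..<N} = {..<j} \<union> insert j {j<..<N}" using j by auto
    also have "sum f \<dots> = sum f {..<j} + sum f (insert j {j<..<N})"
      by (rule sum.union_disjoint) auto
    finally show ?thesis by simp
  qed
  have "(\<Sum>i<N. ?I i / emeasure m (F i))
      = (\<Sum>i<j. ?I i / emeasure m (F i)) + (?I j / emeasure m (F j)
        + (\<Sum>i\<in>{j<..<N}. ?I i / emeasure m (F i)))"
    by (rule split)
  also have "(\<Sum>i<j. ?I i / emeasure m (F i)) = 0" using zero by simp
  also have "(\<Sum>i\<in>{j<..<N}. ?I i / emeasure m (F i)) \<le> load E N j (T (- h) y)"
    unfolding load_def by (intro sum_mono divide_right_mono_ennreal later)
  also have "\<dots> \<le> 1" using E(2)[OF j h(2)] by simp
  finally have "(\<Sum>i<N. ?I i / emeasure m (F i)) \<le> 0 + (?I j / emeasure m (F j) + 1)"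
    by (simp add: add_left_mono)
  also have "\<dots> \<le> 1 + 1" using add_right_mono[OF one, of 1] by simp
  finally show ?thesis by simp
qed

text \<open>Two estimates for the total measure \<open>W\<close> of the kept points are combined:
  \<theta> times \<open>W\<close> is at most twice the integral of \<phi> by the overlap bound, and
  the sets \<open>D j\<close> have total measure at most \<open>(1 + c) * W\<close> by
  temperedness.\<close>

lemma maximal_inequality_disjoint:
  assumes D: "\<And>j. D j \<in> sets \<mu>" "disjoint_family_on D {..<N}"
    and [measurable]: "\<phi> \<in> borel_measurable borel"
    and large: "\<And>j x. j < N \<Longrightarrow> x \<in> D j \<Longrightarrow>
      \<theta> * emeasure m (F j) \<le> (\<integral>\<^sup>+g. indicator (F j) g * \<phi> (T g x) \<partial>m)"
  shows "\<theta> * emeasure \<mu> (\<Union>j<N. D j) \<le> (1 + c) * (2 * (\<integral>\<^sup>+x. \<phi> x \<partial>\<mu>))"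
proof -
  obtain E where "\<forall>j<N. E j \<in> sets \<mu> \<and> E j = {x \<in> D j. load E N j x < 1}"
    using greedy_selection[OF D(1), of N] by (rule exE)
  then have E: "E j \<in> sets \<mu>" and E_iff: "x \<in> E j \<longleftrightarrow> x \<in> D j \<and> load E N j x < 1" if "j < N" for j x
    using that by auto
  have D_borel [measurable]: "D j \<in> sets borel" for j using D(1) by (simp add: sets_\<mu>)
  have E_borel: "E j \<in> sets borel" if "j < N" for j using E[OF that] by (simp add: sets_\<mu>)
  define W where "W = (\<Sum>j<N. emeasure \<mu> (E j))"
  have F0: "emeasure m (F j) \<noteq> 0" "emeasure m (F j) \<noteq> \<infinity>" for j
    using F_pos[of j] F_finite[of j] by auto
  \<comment> \<open>On \<open>E j\<close> the average of \<phi> over the translate is at least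
    \<theta>; integrating over \<open>E j\<close> and passing to the adjoint leaves \<phi> weighted
    by the coverage from stage \<open>j\<close>.\<close>
  have hit: "\<theta> * emeasure \<mu> (E j) \<le> (\<integral>\<^sup>+y. \<phi> y *
      ((\<integral>\<^sup>+g. indicator (F j) g * indicator (E j) (T (- g) y) \<partial>m) / emeasure m (F j)) \<partial>\<mu>)"
    if j: "j < N" for j
  proof -
    note [measurable] = E_borel[OF j]
    have Ej: "E j \<in> sets \<mu>" by (rule E[OF j])
    let ?S = "\<lambda>x. \<integral>\<^sup>+g. indicator (F j) g * \<phi> (T g x) \<partial>m"
    let ?I = "\<lambda>y. \<integral>\<^sup>+g. indicator (F j) g * indicator (E j) (T (- g) y) \<partial>m"
    have [measurable]: "?S \<in> borel_measurable \<mu>"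
      by (rule measurable_orbit_integral(1)[OF F_sets F_finite]) measurable
    have [measurable]: "?I \<in> borel_measurable \<mu>"
      by (rule measurable_orbit_integral(2)[OF F_sets F_finite]) measurable
    have "\<theta> \<le> ?S x / emeasure m (F j)" if "x \<in> E j" for x
    proof -
      have "\<theta> * emeasure m (F j) / emeasure m (F j) \<le> ?S x / emeasure m (F j)"
        using large[OF j, of x] that E_iff[OF j] by (intro divide_right_mono_ennreal) auto
      then show ?thesis using F0[of j] by (simp add: ennreal_mult_divide_eq)
    qed
    then have "(\<integral>\<^sup>+x. \<theta> * indicator (E j) x \<partial>\<mu>) \<le> (\<integral>\<^sup>+x. indicator (E j) x * ?S x / emeasure m (F j) \<partial>\<mu>)"
      by (intro nn_integral_mono) (auto simp: indicator_def)
    also have "\<dots> = (\<integral>\<^sup>+x. indicator (E j) x * ?S x \<partial>\<mu>) / emeasure m (F j)"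
      by (rule nn_integral_divide) measurable
    also have "(\<integral>\<^sup>+x. indicator (E j) x * ?S x \<partial>\<mu>) = (\<integral>\<^sup>+y. \<phi> y * ?I y \<partial>\<mu>)"
      by (rule orbit_integral_adjoint[OF F_sets F_finite, symmetric]) measurable
    also have "(\<integral>\<^sup>+y. \<phi> y * ?I y \<partial>\<mu>) / emeasure m (F j) = (\<integral>\<^sup>+y. \<phi> y * ?I y / emeasure m (F j) \<partial>\<mu>)"
      by (rule nn_integral_divide[symmetric]) measurable
    finally show ?thesis
      using nn_integral_cmult_indicator[OF Ej, of \<theta>] by (simp add: ennreal_times_divide)
  qed
  \<comment> \<open>Summed over \<open>j\<close>, the coverage weights at a point total at most
    2.\<close>
  have upper: "\<theta> * W \<le> 2 * (\<integral>\<^sup>+x. \<phi> x \<partial>\<mu>)"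
  proof -
    let ?I = "\<lambda>j y. (\<integral>\<^sup>+g. indicator (F j) g * indicator (E j) (T (- g) y) \<partial>m) / emeasure m (F j)"
    have [measurable]: "?I j \<in> borel_measurable \<mu>" if "j < N" for j
    proof -
      note [measurable] = E_borel[OF that]
      show ?thesis
        by (intro borel_measurable_divide_ennreal borel_measurable_const measurable_orbit_integral(2)
          F_sets F_finite) measurable
    qed
    have "\<theta> * W \<le> (\<Sum>j<N. \<integral>\<^sup>+y. \<phi> y * ?I j y \<partial>\<mu>)"
      unfolding W_def sum_distrib_left by (intro sum_mono hit) auto
    also have "\<dots> = (\<integral>\<^sup>+y. (\<Sum>j<N. \<phi> y * ?I j y) \<partial>\<mu>)"
      by (rule nn_integral_sum[symmetric]) measurable
    also have "\<dots> \<le> (\<integral>\<^sup>+y. 2 * \<phi> y \<partial>\<mu>)"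
    proof (rule nn_integral_mono)
      fix y
      have "(\<Sum>j<N. ?I j y) \<le> 2" by (rule overlap_le_2) (use E E_iff in auto)
      then show "(\<Sum>j<N. \<phi> y * ?I j y) \<le> 2 * \<phi> y"
        unfolding sum_distrib_left[symmetric] by (subst mult.commute) (rule mult_right_mono, auto)
    qed
    also have "\<dots> = 2 * (\<integral>\<^sup>+x. \<phi> x \<partial>\<mu>)" by (rule nn_integral_cmult) measurable
    finally show ?thesis .
  qed
  have "(\<Sum>j<N. emeasure \<mu> (D j)) \<le> (\<Sum>j<N. emeasure \<mu> (E j)
      + (\<integral>\<^sup>+x. indicator (D j) x * load E N j x \<partial>\<mu>))"
  proof (rule sum_mono)
    fix j assume "j \<in> {..<N}"
    then have j: "j < N" by simp
    note [measurable] = E_borel[OF j]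
    have [measurable]: "load E N j \<in> borel_measurable \<mu>" by (rule measurable_load) (use E in auto)
    have "emeasure \<mu> (D j) = (\<integral>\<^sup>+x. indicator (D j) x \<partial>\<mu>)" using D(1) by simp
    \<comment> \<open>A point of \<open>D j\<close> outside \<open>E j\<close> was discarded because
      its load is at least 1.\<close>
    also have "\<dots> \<le> (\<integral>\<^sup>+x. indicator (E j) x + indicator (D j) x * load E N j x \<partial>\<mu>)"
      using E_iff[OF j] by (intro nn_integral_mono) (auto simp: indicator_def not_less)
    also have "\<dots> = emeasure \<mu> (E j) + (\<integral>\<^sup>+x. indicator (D j) x * load E N j x \<partial>\<mu>)"
      using E[OF j] by (subst nn_integral_add) auto
    finally show "emeasure \<mu> (D j) \<le> \<dots>" .
  qed
  also have "\<dots> = W + (\<Sum>j<N. \<integral>\<^sup>+x. indicator (D j) x * load E N j x \<partial>\<mu>)"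
    unfolding W_def by (rule sum.distrib)
  also have "(\<Sum>j<N. \<integral>\<^sup>+x. indicator (D j) x * load E N j x \<partial>\<mu>) \<le> c * W"
  proof -
    \<comment> \<open>By adjointness, \<open>?Q j i\<close> is the share of the load on
      \<open>D j\<close> caused by stage \<open>i\<close>, now written as an integral over the kept
      points of \<open>E i\<close>.\<close>
    let ?Q = "\<lambda>j i. (\<integral>\<^sup>+y. indicator (E i) y *
      (\<integral>\<^sup>+g. indicator (P j i) g * indicator (D j) (T g y) \<partial>m) \<partial>\<mu>) / emeasure m (F i)"
    have "(\<integral>\<^sup>+x. indicator (D j) x * load E N j x \<partial>\<mu>) = (\<Sum>i | i \<in> {..<N} \<and> j < i. ?Q j i)" for j
    proof -
      let ?I = "\<lambda>i x. \<integral>\<^sup>+g. indicator (P j i) g * indicator (E i) (T (- g) x) \<partial>m"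
      have I [measurable]: "?I i \<in> borel_measurable \<mu>" if "i < N" for i
      proof -
        note [measurable] = E_borel[OF that]
        show ?thesis by (rule measurable_orbit_integral(2)[OF P_sets P_finite]) measurable
      qed
      have "(\<integral>\<^sup>+x. indicator (D j) x * load E N j x \<partial>\<mu>)
          = (\<integral>\<^sup>+x. (\<Sum>i\<in>{j<..<N}. indicator (D j) x * ?I i x / emeasure m (F i)) \<partial>\<mu>)"
        unfolding load_def sum_distrib_left by (simp add: ennreal_times_divide)
      also have "\<dots> = (\<Sum>i\<in>{j<..<N}. \<integral>\<^sup>+x. indicator (D j) x * ?I i x / emeasure m (F i) \<partial>\<mu>)"
        by (rule nn_integral_sum) (use I in auto)
      also have "\<dots> = (\<Sum>i\<in>{j<..<N}. ?Q j i)"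
      proof (rule sum.cong[OF refl])
        fix i assume "i \<in> {j<..<N}"
        then have i: "i < N" by simp
        note [measurable] = E_borel[OF i] I[OF i]
        have "(\<integral>\<^sup>+x. indicator (D j) x * ?I i x / emeasure m (F i) \<partial>\<mu>)
            = (\<integral>\<^sup>+x. indicator (D j) x * ?I i x \<partial>\<mu>) / emeasure m (F i)"
          by (rule nn_integral_divide) measurable
        also have "(\<integral>\<^sup>+x. indicator (D j) x * ?I i x \<partial>\<mu>) = (\<integral>\<^sup>+y. indicator (E i) y *
            (\<integral>\<^sup>+g. indicator (P j i) g * indicator (D j) (T g y) \<partial>m) \<partial>\<mu>)"
          by (rule orbit_integral_adjoint[OF P_sets P_finite]) measurable
        finally show "(\<integral>\<^sup>+x. indicator (D j) x * ?I i x / emeasure m (F i) \<partial>\<mu>) = ?Q j i" .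
      qed
      also have "{j<..<N} = {i. i \<in> {..<N} \<and> j < i}" by auto
      finally show ?thesis .
    qed
    then have "(\<Sum>j<N. \<integral>\<^sup>+x. indicator (D j) x * load E N j x \<partial>\<mu>)
        = (\<Sum>j<N. \<Sum>i | i \<in> {..<N} \<and> j < i. ?Q j i)" by simp
    \<comment> \<open>Exchanging the sums fixes the later stage \<open>i\<close> and collects all
      \<open>j < i\<close>, the form in which temperedness applies.\<close>
    also have "\<dots> = (\<Sum>i<N. \<Sum>j | j \<in> {..<N} \<and> j < i. ?Q j i)"
      by (rule sum.swap_restrict) auto
    also have "\<dots> \<le> (\<Sum>i<N. c * emeasure \<mu> (E i))"
    proof (rule sum_mono)
      fix i assume "i \<in> {..<N}"
      then have i: "i < N" by simp
      note [measurable] = E_borel[OF i]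
      have Ei: "E i \<in> sets \<mu>" by (rule E[OF i])
      let ?J = "\<lambda>j y. \<integral>\<^sup>+g. indicator (P j i) g * indicator (D j) (T g y) \<partial>m"
      have J [measurable]: "?J j \<in> borel_measurable \<mu>" for j
        by (rule measurable_orbit_integral(1)[OF P_sets P_finite]) measurable
      \<comment> \<open>The sets \<open>D j\<close> are disjoint, so each \<open>g\<close> counts
        for at most one \<open>j\<close>, and the sum is bounded by the measure of the union of the
        sets \<open>P j i\<close> instead of the sum of their measures.\<close>
      have J_sum: "(\<Sum>j<i. ?J j y) \<le> c * emeasure m (F i)" for y
      proof -
        have "(\<Sum>j<i. ?J j y) = (\<integral>\<^sup>+g. (\<Sum>j<i. indicator (P j i) g * indicator (D j) (T g y)) \<partial>m)"
          by (rule nn_integral_sum[symmetric]) measurable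
        also have "\<dots> \<le> (\<integral>\<^sup>+g. indicator (\<Union>j<i. P j i) g \<partial>m)"
        proof (rule nn_integral_mono)
          fix g
          show "(\<Sum>j<i. indicator (P j i) g * indicator (D j) (T g y)) \<le> (indicator (\<Union>j<i. P j i) g :: ennreal)"
          proof (cases "\<exists>k<i. g \<in> P k i \<and> T g y \<in> D k")
            case True
            then obtain k where k: "k < i" "g \<in> P k i" "T g y \<in> D k" by blast
            have "T g y \<notin> D j" if "j < i" "j \<noteq> k" for j
              using disjoint_family_onD[OF D(2), of j k] that k i by auto
            then have "(\<Sum>j<i. indicator (P j i) g * indicator (D j) (T g y))
                = (\<Sum>j<i. if j = k then 1 else 0 :: ennreal)"
              using k by (intro sum.cong) (auto simp: indicator_def)
            then show ?thesis using k by (auto simp: indicator_def)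
          next
            case False
            then have "(\<Sum>j<i. indicator (P j i) g * indicator (D j) (T g y)) = (0 :: ennreal)"
              by (intro sum.neutral) (auto simp: indicator_def)
            then show ?thesis by simp
          qed
        qed
        also have "\<dots> = emeasure m (\<Union>j<i. P j i)" by (rule nn_integral_indicator) auto
        also have "\<dots> \<le> c * emeasure m (F i)" by (rule tempered)
        finally show ?thesis .
      qed
      have "{j. j \<in> {..<N} \<and> j < i} = {..<i}" using i by auto
      then have "(\<Sum>j | j \<in> {..<N} \<and> j < i. ?Q j i) = (\<Sum>j<i. ?Q j i)" by simp
      also have "\<dots> = (\<Sum>j<i. \<integral>\<^sup>+y. indicator (E i) y * ?J j y \<partial>\<mu>) / emeasure m (F i)"
        by (simp add: divide_ennreal_def sum_distrib_right)
      also have "(\<Sum>j<i. \<integral>\<^sup>+y. indicator (E i) y * ?J j y \<partial>\<mu>)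
          = (\<integral>\<^sup>+y. (\<Sum>j<i. indicator (E i) y * ?J j y) \<partial>\<mu>)"
        by (rule nn_integral_sum[symmetric]) measurable
      also have "\<dots> \<le> (\<integral>\<^sup>+y. (c * emeasure m (F i)) * indicator (E i) y \<partial>\<mu>)"
        using J_sum by (intro nn_integral_mono) (auto simp: indicator_def)
      also have "\<dots> = (c * emeasure m (F i)) * emeasure \<mu> (E i)"
        by (rule nn_integral_cmult_indicator[OF Ei])
      also have "\<dots> / emeasure m (F i) = c * emeasure \<mu> (E i)"
        using ennreal_mult_divide_eq[of "emeasure m (F i)" "c * emeasure \<mu> (E i)"] F0[of i]
        by (simp add: mult_ac)
      finally show "(\<Sum>j | j \<in> {..<N} \<and> j < i. ?Q j i) \<le> c * emeasure \<mu> (E i)"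
        by (simp add: divide_right_mono_ennreal)
    qed
    finally show ?thesis unfolding W_def by (simp add: sum_distrib_left)
  qed
  finally have "(\<Sum>j<N. emeasure \<mu> (D j)) \<le> (1 + c) * W"
    by (simp add: add_left_mono distrib_right)
  moreover have "emeasure \<mu> (\<Union>j<N. D j) \<le> (\<Sum>j<N. emeasure \<mu> (D j))"
    by (rule emeasure_subadditive_finite) (use D in auto)
  ultimately have "\<theta> * emeasure \<mu> (\<Union>j<N. D j) \<le> \<theta> * ((1 + c) * W)"
    by (meson mult_left_mono order_trans zero_le)
  also have "\<dots> = (1 + c) * (\<theta> * W)" by (simp add: mult_ac)
  also have "\<dots> \<le> (1 + c) * (2 * (\<integral>\<^sup>+x. \<phi> x \<partial>\<mu>))" by (intro mult_left_mono upper) simp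
  finally show ?thesis .
qed

end

section \<open>The pointwise ergodic theorem\<close>

locale folner_action = tempered_action m T \<mu> F P c
  for m :: "'g::topological_group_add measure"
    and T :: "'g \<Rightarrow> 'x::topological_space \<Rightarrow> 'x"
    and \<mu> :: "'x measure" and F P c +
  assumes c_finite: "c < \<infinity>"
    and folner: "(\<lambda>k. measure m (sym_diff ((+) a ` F k) (F k)) / measure m (F k)) \<longlonglongrightarrow> 0"
begin

text \<open>Boundedness is required at every point, not modulo null sets, so that the averages along
  every single orbit exist.\<close>

definition bounded_measurable :: "real \<Rightarrow> ('x \<Rightarrow> real) \<Rightarrow> bool" where
  "bounded_measurable B h \<longleftrightarrow> h \<in> borel_measurable borel \<and> (\<forall>x. \<bar>h x\<bar> \<le> B)"

definition avg :: "nat \<Rightarrow> ('x \<Rightarrow> real) \<Rightarrow> 'x \<Rightarrow> real" where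
  "avg k h x = (LINT g:F k|m. h (T g x)) / measure m (F k)"

section \<open>Orbit averages of bounded functions\<close>

lemma F_measure_pos: "0 < measure m (F k)"
  using F_pos[of k] F_finite[of k] by (simp add: measure_def enn2real_positive_iff)

lemma F_emeasure: "emeasure m (F k) = ennreal (measure m (F k))"
  using F_finite[of k] by (intro emeasure_eq_ennreal_measure) auto

lemma
  assumes "bounded_measurable B h"
  shows bm_borel: "h \<in> borel_measurable borel" and bm_le: "\<bar>h x\<bar> \<le> B"
  using assms unfolding bounded_measurable_def by auto

lemma integrable_bm: "bounded_measurable B h \<Longrightarrow> integrable \<mu> h"
  unfolding bounded_measurable_def
  by (intro integrable_const_bound[where B=B]) (auto simp: measurable_cong_sets[OF sets_\<mu> refl])

lemma bm_T:
  assumes "bounded_measurable B h"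
  shows "bounded_measurable B (\<lambda>x. h (T a x))"
proof -
  have [measurable]: "h \<in> borel_measurable borel" by (rule bm_borel[OF assms])
  have "(\<lambda>x. h (T a x)) \<in> borel_measurable borel" by measurable
  then show ?thesis using assms unfolding bounded_measurable_def by auto
qed

lemma integrable_orbit:
  assumes "bounded_measurable B h" "K \<in> sets m" "emeasure m K < \<infinity>"
  shows "set_integrable m K (\<lambda>g. h (T g x))"
proof -
  have [measurable]: "h \<in> borel_measurable borel" by (rule bm_borel[OF assms(1)])
  have "(\<lambda>g. h (T g x)) \<in> borel_measurable m" by measurable
  then show ?thesis
    unfolding set_integrable_def
    using assms(2,3) bm_le[OF assms(1)]
    by (intro integrableI_bounded_set_indicator[where B=B]) auto
qed

lemma integrable_orbit_F: "bounded_measurable B h \<Longrightarrow> set_integrable m (F k) (\<lambda>g. h (T g x))"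
  by (rule integrable_orbit[OF _ F_sets F_finite])

lemma avg_diff:
  assumes "bounded_measurable B u" "bounded_measurable B' v"
  shows "avg k (\<lambda>x. u x - v x) x = avg k u x - avg k v x"
  using set_integral_diff(2)[OF integrable_orbit_F[OF assms(1)] integrable_orbit_F[OF assms(2)]]
  unfolding avg_def by (simp add: diff_divide_distrib)

lemma avg_midpoint:
  assumes "bounded_measurable B u" "bounded_measurable B' v"
  shows "avg k (\<lambda>x. (u x + v x) / 2) x = (avg k u x + avg k v x) / 2"
  using set_integral_add(2)[OF integrable_orbit_F[OF assms(1), of k x] integrable_orbit_F[OF assms(2), of k x]]
  unfolding avg_def by simp (simp add: add_divide_distrib)

lemma avg_abs:
  assumes "bounded_measurable B u"
  shows "\<bar>avg k u x\<bar> \<le> avg k (\<lambda>x. \<bar>u x\<bar>) x"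
  using set_integral_norm_bound[OF integrable_orbit_F[OF assms, of k x]] F_measure_pos[of k]
  unfolding avg_def by (simp add: divide_right_mono)

text \<open>Links the real averages to the extended nonnegative integrals of the covering
  argument.\<close>

lemma avg_nonneg_eq:
  assumes h: "bounded_measurable B h" "\<And>x. 0 \<le> h x"
  shows "(\<integral>\<^sup>+g. indicator (F k) g * ennreal (h (T g x)) \<partial>m) = ennreal (avg k h x) * emeasure m (F k)"
    and "0 \<le> avg k h x"
proof -
  have "0 \<le> (LINT g:F k|m. h (T g x))"
    unfolding set_lebesgue_integral_def using h(2) by (intro integral_nonneg_AE) auto
  then show pos: "0 \<le> avg k h x" unfolding avg_def by simp
  have "(\<integral>\<^sup>+g. indicator (F k) g * ennreal (h (T g x)) \<partial>m)
      = (\<integral>\<^sup>+g. ennreal (indicator (F k) g *\<^sub>R h (T g x)) \<partial>m)"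
    by (intro nn_integral_cong) (auto simp: indicator_def)
  also have "\<dots> = ennreal (LINT g:F k|m. h (T g x))"
    using integrable_orbit_F[OF h(1)] h(2) unfolding set_lebesgue_integral_def set_integrable_def
    by (intro nn_integral_eq_integral) auto
  also have "\<dots> = ennreal (avg k h x * measure m (F k))"
    unfolding avg_def using F_measure_pos[of k] by simp
  also have "\<dots> = ennreal (avg k h x) * emeasure m (F k)"
    unfolding F_emeasure using pos by (intro ennreal_mult) auto
  finally show "(\<integral>\<^sup>+g. indicator (F k) g * ennreal (h (T g x)) \<partial>m) = ennreal (avg k h x) * emeasure m (F k)" .
qed

text \<open>As for Fubini above, \<open>m\<close> is replaced by the finite measure
  \<open>density m (indicator K)\<close>.\<close>

lemma measurable_set_integral_on:
  fixes \<phi> :: "'g \<Rightarrow> 'x \<Rightarrow> 'b::{banach, second_countable_topology}"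
  assumes K: "K \<in> sets m" "emeasure m K < \<infinity>"
    and [measurable]: "(\<lambda>(g, x). \<phi> g x) \<in> borel_measurable (borel \<Otimes>\<^sub>M borel)"
  shows "(\<lambda>x. LINT g:K|m. \<phi> g x) \<in> borel_measurable borel"
proof -
  define \<nu> where "\<nu> = density m (indicator K)"
  have [measurable_cong]: "sets \<nu> = sets m" by (simp add: \<nu>_def)
  interpret \<nu>: finite_measure \<nu>
    by (rule finite_measureI) (use K in \<open>simp add: \<nu>_def emeasure_density\<close>)
  have slice: "(\<lambda>g. \<phi> g x) \<in> borel_measurable m" for x
    by measurable
  have "(\<integral>g. \<phi> g x \<partial>\<nu>) = (LINT g:K|m. \<phi> g x)" for x
  proof -
    have "\<nu> = density m (\<lambda>g. ennreal (indicator K g))"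
      unfolding \<nu>_def by (simp add: ennreal_indicator)
    then show ?thesis
      unfolding set_lebesgue_integral_def
      using integral_density[OF slice, of "indicator K"] K by simp
  qed
  moreover have "(\<lambda>x. \<integral>g. \<phi> g x \<partial>\<nu>) \<in> borel_measurable borel"
    by (rule \<nu>.borel_measurable_lebesgue_integral) measurable
  ultimately show ?thesis by simp
qed

lemma measurable_avg:
  assumes "bounded_measurable B h"
  shows "avg k h \<in> borel_measurable borel"
proof -
  have [measurable]: "h \<in> borel_measurable borel" by (rule bm_borel[OF assms])
  have "(\<lambda>x. LINT g:F k|m. h (T g x)) \<in> borel_measurable borel"
    by (rule measurable_set_integral_on[OF F_sets F_finite]) measurable
  then show ?thesis unfolding avg_def[abs_def] by measurable
qed

text \<open>Sorting points by the first index with a large average makes the sets disjoint; the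
  resulting bound does not depend on the number of stages, so continuity from below covers all
  indices.\<close>

lemma maximal_inequality:
  assumes h: "bounded_measurable B h" "\<And>x. 0 \<le> h x" and \<theta>: "0 \<le> \<theta>"
  shows "ennreal \<theta> * emeasure \<mu> {x. \<exists>k. \<theta> < avg k h x} \<le> (1 + c) * (2 * (\<integral>\<^sup>+x. h x \<partial>\<mu>))"
proof -
  note [measurable] = measurable_avg[OF h(1)] bm_borel[OF h(1)]
  define A where "A k = {x. \<theta> < avg k h x}" for k
  have A: "A k \<in> sets \<mu>" for k
  proof -
    have "{x \<in> space borel. \<theta> < avg k h x} \<in> sets borel" by measurable
    then show ?thesis by (simp add: A_def sets_\<mu>)
  qed
  have sub: "disjointed A k \<subseteq> A k" for k by (rule disjointed_subset)
  have "ennreal \<theta> * emeasure \<mu> (\<Union>k<N. disjointed A k) \<le> (1 + c) * (2 * (\<integral>\<^sup>+x. h x \<partial>\<mu>))" for N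
  proof (rule maximal_inequality_disjoint)
    show "disjointed A j \<in> sets \<mu>" for j
      using sets.range_disjointed_sets[of A \<mu>] A by auto
    show "disjoint_family_on (disjointed A) {..<N}"
      using disjoint_family_disjointed[of A] by (rule disjoint_family_on_mono[rotated]) simp
    show "(\<lambda>x. ennreal (h x)) \<in> borel_measurable borel" by measurable
    fix j x assume "x \<in> disjointed A j"
    then have "\<theta> \<le> avg j h x" using sub unfolding A_def by force
    then show "ennreal \<theta> * emeasure m (F j) \<le> (\<integral>\<^sup>+g. indicator (F j) g * ennreal (h (T g x)) \<partial>m)"
      unfolding avg_nonneg_eq(1)[OF h] by (intro mult_right_mono ennreal_leI) auto
  qed
  then have le: "ennreal \<theta> * emeasure \<mu> (\<Union>k<N. A k) \<le> (1 + c) * (2 * (\<integral>\<^sup>+x. h x \<partial>\<mu>))" for N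
    by (simp add: lessThan_atLeast0 finite_UN_disjointed_eq)
  have "(\<lambda>N. emeasure \<mu> (\<Union>k<N. A k)) \<longlonglongrightarrow> emeasure \<mu> (\<Union>N. \<Union>k<N. A k)"
    by (intro Lim_emeasure_incseq incseq_SucI) (use A in \<open>auto simp: less_Suc_eq\<close>)
  then have "(\<lambda>N. ennreal \<theta> * emeasure \<mu> (\<Union>k<N. A k)) \<longlonglongrightarrow> ennreal \<theta> * emeasure \<mu> (\<Union>N. \<Union>k<N. A k)"
    by (intro ennreal_tendsto_cmult) auto
  then have "ennreal \<theta> * emeasure \<mu> (\<Union>N. \<Union>k<N. A k) \<le> (1 + c) * (2 * (\<integral>\<^sup>+x. h x \<partial>\<mu>))"
    by (rule LIMSEQ_le_const2) (use le in auto)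
  also have "(\<Union>N. \<Union>k<N. A k) = {x. \<exists>k. \<theta> < avg k h x}" unfolding A_def by auto
  finally show ?thesis .
qed

text \<open>Composing with \<open>T a\<close> replaces \<open>F k\<close> by its left translate by
  \<open>a\<close>. The two integrals differ only on the symmetric difference, which is negligible
  by the Foelner condition.\<close>

lemma avg_T_tendsto:
  assumes h: "bounded_measurable B h"
  shows "(\<lambda>k. avg k h x - avg k (\<lambda>y. h (T a y)) x) \<longlonglongrightarrow> 0"
proof (rule Lim_null_comparison)
  have B: "0 \<le> B" using bm_le[OF h, of x] by linarith
  show "(\<lambda>k. B * (measure m (sym_diff ((+) a ` F k) (F k)) / measure m (F k))) \<longlonglongrightarrow> 0"
    using tendsto_mult_right_zero[OF folner[of a], of B] .
  show "\<forall>\<^sub>F k in sequentially. norm (avg k h x - avg k (\<lambda>y. h (T a y)) x)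
      \<le> B * (measure m (sym_diff ((+) a ` F k) (F k)) / measure m (F k))"
  proof (intro always_eventually allI)
    fix k
    let ?G = "(+) a ` F k"
    have [measurable]: "h \<in> borel_measurable borel" by (rule bm_borel[OF h])
    \<comment> \<open>As a preimage under a translation, the translate of \<open>F k\<close> is
      measurable.\<close>
    have G_eq: "?G = (+) (- a) -` F k"
      by (force simp: image_iff add.assoc[symmetric])
    have "(+) (- a) -` F k \<inter> space m \<in> sets m"
      by (rule measurable_sets[of _ m borel]) auto
    then have G [measurable]: "?G \<in> sets m" using G_eq by simp
    then have [measurable]: "?G \<in> sets borel" by (simp add: sets_m)
    have G_fin: "emeasure m ?G < \<infinity>"
      using left_invariant F_finite[of k] unfolding left_invariant_measure_def by auto
    have "(LINT g:?G|m. h (T g x)) = (\<integral>g. indicator ?G g *\<^sub>R h (T g x) \<partial>distr m m ((+) a))"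
      unfolding set_lebesgue_integral_def distr_plus ..
    also have "\<dots> = (\<integral>g. indicator ?G (a + g) *\<^sub>R h (T (a + g) x) \<partial>m)"
      by (rule integral_distr) measurable
    also have "\<dots> = (LINT g:F k|m. h (T a (T g x)))"
      unfolding set_lebesgue_integral_def
      by (intro Bochner_Integration.integral_cong) (auto simp: indicator_def T_add)
    finally have shift: "(LINT g:F k|m. h (T a (T g x))) = (LINT g:?G|m. h (T g x))" by simp
    have int: "set_integrable m (F k) (\<lambda>g. h (T g x))" "set_integrable m ?G (\<lambda>g. h (T g x))"
      by (rule integrable_orbit[OF h F_sets F_finite], rule integrable_orbit[OF h G G_fin])
    have S: "sym_diff ?G (F k) \<in> sets m" by measurable
    have S_fin: "emeasure m (sym_diff ?G (F k)) < \<infinity>"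
    proof -
      have "emeasure m (sym_diff ?G (F k)) \<le> emeasure m (?G \<union> F k)"
        by (intro emeasure_mono) auto
      also have "\<dots> \<le> emeasure m ?G + emeasure m (F k)" by (intro emeasure_subadditive) auto
      also have "\<dots> < \<infinity>" using G_fin F_finite[of k] by simp
      finally show ?thesis .
    qed
    have "\<bar>(LINT g:F k|m. h (T g x)) - (LINT g:?G|m. h (T g x))\<bar>
        = \<bar>\<integral>g. indicator (F k) g *\<^sub>R h (T g x) - indicator ?G g *\<^sub>R h (T g x) \<partial>m\<bar>"
      using int unfolding set_lebesgue_integral_def set_integrable_def by simp
    also have "\<dots> \<le> (\<integral>g. indicator (sym_diff ?G (F k)) g *\<^sub>R B \<partial>m)"
    proof -
      have "\<bar>indicator (F k) g *\<^sub>R h (T g x) - indicator ?G g *\<^sub>R h (T g x)\<bar>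
          \<le> indicator (sym_diff ?G (F k)) g *\<^sub>R B" for g
        using bm_le[OF h, of "T g x"] by (auto simp: indicator_def simp del: image_iff)
      moreover have "integrable m (\<lambda>g. indicator (sym_diff ?G (F k)) g *\<^sub>R B)"
        by (rule integrableI_bounded_set_indicator[where B="\<bar>B\<bar>"]) (use S S_fin in auto)
      ultimately show ?thesis
        using int unfolding set_integrable_def
        by (intro order_trans[OF integral_abs_bound] integral_mono) auto
    qed
    also have "\<dots> = B * measure m (sym_diff ?G (F k))"
      using S by (simp add: mult.commute)
    finally have "\<bar>(LINT g:F k|m. h (T g x)) - (LINT g:?G|m. h (T g x))\<bar> / measure m (F k)
        \<le> B * measure m (sym_diff ?G (F k)) / measure m (F k)"
      by (rule divide_right_mono) simp
    then show "norm (avg k h x - avg k (\<lambda>y. h (T a y)) x)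
        \<le> B * (measure m (sym_diff ?G (F k)) / measure m (F k))"
      unfolding avg_def shift diff_divide_distrib[symmetric] by simp
  qed
qed

text \<open>The exceptional null set in \<open>inv\<close> varies with \<open>g\<close>. Fubini
  turns this around: for almost every \<open>x\<close> the equation holds for almost every
  \<open>g\<close> in \<open>F k\<close>.\<close>

lemma avg_invariant:
  assumes h: "bounded_measurable B h" and inv: "\<And>g. AE x in \<mu>. h (T g x) = h x"
  shows "AE x in \<mu>. \<forall>k. avg k h x = h x"
  unfolding AE_all_countable
proof
  fix k
  have [measurable]: "h \<in> borel_measurable borel" by (rule bm_borel[OF h])
  let ?\<phi> = "\<lambda>g x. ennreal \<bar>h (T g x) - h x\<bar>"
  have meas: "(\<lambda>(g, x). ?\<phi> g x) \<in> borel_measurable (m \<Otimes>\<^sub>M \<mu>)" by measurable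
  have "(\<integral>\<^sup>+x. ?\<phi> g x \<partial>\<mu>) = 0" for g
    using inv[of g] by (subst nn_integral_0_iff_AE) auto
  then have "(\<integral>\<^sup>+x. (\<integral>\<^sup>+g. indicator (F k) g * ?\<phi> g x \<partial>m) \<partial>\<mu>) = 0"
    using Fubini_on[OF F_sets F_finite meas] by simp
  then have "AE x in \<mu>. (\<integral>\<^sup>+g. indicator (F k) g * ?\<phi> g x \<partial>m) = 0"
    using measurable_nn_integral_on[OF F_sets F_finite meas] by (subst (asm) nn_integral_0_iff_AE) auto
  then show "AE x in \<mu>. avg k h x = h x"
  proof eventually_elim
    case (elim x)
    then have "AE g in m. indicator (F k) g * ?\<phi> g x = 0"
      by (subst (asm) nn_integral_0_iff_AE) auto
    then have "(\<integral>g. indicator (F k) g *\<^sub>R h (T g x) \<partial>m) = (\<integral>g. indicator (F k) g *\<^sub>R h x \<partial>m)"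
      by (intro integral_cong_AE) (auto simp: indicator_def elim!: eventually_mono split: if_splits)
    then show "avg k h x = h x"
      unfolding avg_def set_lebesgue_integral_def using F_measure_pos[of k] by simp
  qed
qed

lemma bm_abs: "bounded_measurable B u \<Longrightarrow> bounded_measurable B (\<lambda>x. \<bar>u x\<bar>)"
  unfolding bounded_measurable_def by auto

lemma bm_diff:
  assumes "bounded_measurable B u" "bounded_measurable B' v"
  shows "bounded_measurable (B + B') (\<lambda>x. u x - v x)"
  unfolding bounded_measurable_def
proof (intro conjI allI)
  show "(\<lambda>x. u x - v x) \<in> borel_measurable borel"
    by (intro borel_measurable_diff bm_borel[OF assms(1)] bm_borel[OF assms(2)])
  show "\<bar>u x - v x\<bar> \<le> B + B'" for x
    using bm_le[OF assms(1), of x] bm_le[OF assms(2), of x] by linarith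
qed

lemma bm_midpoint:
  assumes "bounded_measurable B u" "bounded_measurable B v"
  shows "bounded_measurable B (\<lambda>x. (u x + v x) / 2)"
  unfolding bounded_measurable_def
proof (intro conjI allI)
  show "(\<lambda>x. (u x + v x) / 2) \<in> borel_measurable borel"
    by (intro borel_measurable_divide borel_measurable_add borel_measurable_const
      bm_borel[OF assms(1)] bm_borel[OF assms(2)])
  show "\<bar>(u x + v x) / 2\<bar> \<le> B" for x
    using bm_le[OF assms(1), of x] bm_le[OF assms(2), of x] by (simp add: abs_le_iff)
qed

lemma bm_square:
  assumes "bounded_measurable B u"
  shows "bounded_measurable (B\<^sup>2) (\<lambda>x. (u x)\<^sup>2)"
  unfolding bounded_measurable_def
proof (intro conjI allI)
  show "(\<lambda>x. (u x)\<^sup>2) \<in> borel_measurable borel"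
    by (intro borel_measurable_power bm_borel[OF assms])
  show "\<bar>(u x)\<^sup>2\<bar> \<le> B\<^sup>2" for x
    using power_mono[OF bm_le[OF assms, of x], of 2] by simp
qed

section \<open>The mean ergodic theorem by minimizing the L^2-norm\<close>

lemma integral_T:
  assumes "h \<in> borel_measurable borel"
  shows "(\<integral>x. h (T a x) \<partial>\<mu>) = (\<integral>x. (h x :: real) \<partial>\<mu>)"
  using integral_distr[of "T a" \<mu> \<mu> h] assms by (simp add: distr_T measurable_cong_sets[OF sets_\<mu> refl])

text \<open>The approximants of \<open>f\<close> stand in for the convex hull of its orbit in von Neumann's
  argument: they are closed under midpoints and under the action, so that a sequence of approximants
  minimizing the \<open>L\<^sup>2\<close>-norm is Cauchy and has an invariant limit.\<close>

definition approximant :: "real \<Rightarrow> ('x \<Rightarrow> real) \<Rightarrow> ('x \<Rightarrow> real) \<Rightarrow> bool" where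
  "approximant B f v \<longleftrightarrow> bounded_measurable B v \<and>
     (\<forall>x. (\<lambda>k. avg k f x - avg k v x) \<longlonglongrightarrow> 0) \<and>
     (\<forall>A\<in>invariant_sets T \<mu>. (LINT x:A|\<mu>. v x) = (LINT x:A|\<mu>. f x))"

lemma approximant_refl: "bounded_measurable B f \<Longrightarrow> approximant B f f"
  unfolding approximant_def by auto

lemma set_integrable_bm: "bounded_measurable B h \<Longrightarrow> A \<in> sets \<mu> \<Longrightarrow> set_integrable \<mu> A h"
  unfolding set_integrable_def by (intro integrable_mult_indicator integrable_bm) auto

lemma approximant_midpoint:
  assumes u: "approximant B f u" and v: "approximant B f v"
  shows "approximant B f (\<lambda>x. (u x + v x) / 2)"
proof -
  have bm: "bounded_measurable B u" "bounded_measurable B v"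
    using u v unfolding approximant_def by auto
  have "(\<lambda>k. avg k f x - avg k (\<lambda>x. (u x + v x) / 2) x) \<longlonglongrightarrow> 0" for x
  proof -
    have "(\<lambda>k. ((avg k f x - avg k u x) + (avg k f x - avg k v x)) / 2) \<longlonglongrightarrow> (0 + 0) / 2"
      using u v unfolding approximant_def by (intro tendsto_intros) auto
    then show ?thesis by (simp add: avg_midpoint[OF bm] field_simps)
  qed
  moreover have "(LINT x:A|\<mu>. (u x + v x) / 2) = (LINT x:A|\<mu>. f x)" if A: "A \<in> invariant_sets T \<mu>" for A
  proof -
    have "A \<in> sets \<mu>" using A unfolding invariant_sets_def by auto
    then have "(LINT x:A|\<mu>. u x + v x) = (LINT x:A|\<mu>. u x) + (LINT x:A|\<mu>. v x)"
      by (intro set_integral_add(2) set_integrable_bm[OF bm(1)] set_integrable_bm[OF bm(2)])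
    then show ?thesis using u v A unfolding approximant_def by simp
  qed
  ultimately show ?thesis using bm_midpoint[OF bm] unfolding approximant_def by auto
qed

text \<open>The averages stay asymptotic by the Foelner property, and the integrals over almost
  invariant sets are unchanged because \<mu> is preserved.\<close>

lemma approximant_T:
  assumes v: "approximant B f v"
  shows "approximant B f (\<lambda>x. v (T a x))"
proof -
  have bm: "bounded_measurable B v" using v unfolding approximant_def by auto
  note [measurable] = bm_borel[OF bm]
  have "(\<lambda>k. avg k f x - avg k (\<lambda>x. v (T a x)) x) \<longlonglongrightarrow> 0" for x
    using tendsto_add[OF _ avg_T_tendsto[OF bm, of x a], of "\<lambda>k. avg k f x - avg k v x" 0] v
    unfolding approximant_def by simp
  moreover have "(LINT x:A|\<mu>. v (T a x)) = (LINT x:A|\<mu>. f x)" if A: "A \<in> invariant_sets T \<mu>" for A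
  proof -
    have [measurable]: "A \<in> sets borel" using A unfolding invariant_sets_def by (auto simp: sets_\<mu>)
    have inv: "AE x in \<mu>. T a x \<in> A \<longleftrightarrow> x \<in> A" using A unfolding invariant_sets_def by auto
    \<comment> \<open>The indicators of \<open>A\<close> at \<open>x\<close> and at
      \<open>T a x\<close> agree almost everywhere, so the whole integrand becomes a function of
      \<open>T a x\<close>.\<close>
    have "(LINT x:A|\<mu>. v (T a x)) = (\<integral>x. indicator A (T a x) *\<^sub>R v (T a x) \<partial>\<mu>)"
      unfolding set_lebesgue_integral_def
      by (intro integral_cong_AE) (use inv in \<open>auto simp: indicator_def elim!: eventually_mono\<close>)
    also have "\<dots> = (LINT x:A|\<mu>. v x)"
      unfolding set_lebesgue_integral_def by (rule integral_T) measurable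
    finally show ?thesis using v A unfolding approximant_def by simp
  qed
  ultimately show ?thesis using bm_T[OF bm] unfolding approximant_def by auto
qed

text \<open>The Cauchy-Schwarz inequality on a probability space, read off from the nonnegativity of
  the variance of \<open>\<bar>h x\<bar>\<close>.\<close>

lemma integral_abs_le_sqrt:
  assumes "bounded_measurable B h"
  shows "(\<integral>x. \<bar>h x\<bar> \<partial>\<mu>) \<le> sqrt (\<integral>x. (h x)\<^sup>2 \<partial>\<mu>)"
proof -
  have "0 \<le> variance (\<lambda>x. \<bar>h x\<bar>)" by (rule variance_positive)
  also have "\<dots> = (\<integral>x. (h x)\<^sup>2 \<partial>\<mu>) - (\<integral>x. \<bar>h x\<bar> \<partial>\<mu>)\<^sup>2"
    using variance_eq[of "\<lambda>x. \<bar>h x\<bar>"] integrable_bm[OF bm_abs[OF assms]]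
      integrable_bm[OF bm_square[OF assms]] by simp
  finally show ?thesis by (intro real_le_rsqrt) simp
qed

text \<open>Parallelogram law: the midpoint is again an approximant, so its squared norm is at least
  \<open>I\<close>, and \<open>2 * (I + a) + 2 * (I + a) - 4 * I = 4 * a\<close>.\<close>

lemma approximants_near_minimum:
  assumes u: "approximant B f u" "(\<integral>x. (u x)\<^sup>2 \<partial>\<mu>) \<le> I + a"
    and v: "approximant B f v" "(\<integral>x. (v x)\<^sup>2 \<partial>\<mu>) \<le> I + a"
    and I: "\<And>w. approximant B f w \<Longrightarrow> I \<le> (\<integral>x. (w x)\<^sup>2 \<partial>\<mu>)"
  shows "(\<integral>x. \<bar>u x - v x\<bar> \<partial>\<mu>) \<le> sqrt (4 * a)"
proof -
  have bm: "bounded_measurable B u" "bounded_measurable B v"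
    using u v unfolding approximant_def by auto
  have int: "integrable \<mu> (\<lambda>x. (u x)\<^sup>2)" "integrable \<mu> (\<lambda>x. (v x)\<^sup>2)"
      "integrable \<mu> (\<lambda>x. ((u x + v x) / 2)\<^sup>2)"
    by (rule integrable_bm[OF bm_square] bm bm_midpoint)+
  have "(\<integral>x. (u x - v x)\<^sup>2 \<partial>\<mu>)
      = (\<integral>x. 2 * (u x)\<^sup>2 + 2 * (v x)\<^sup>2 - 4 * ((u x + v x) / 2)\<^sup>2 \<partial>\<mu>)"
    by (intro Bochner_Integration.integral_cong) (auto simp: power2_eq_square field_simps)
  also have "\<dots> = 2 * (\<integral>x. (u x)\<^sup>2 \<partial>\<mu>) + 2 * (\<integral>x. (v x)\<^sup>2 \<partial>\<mu>) - 4 * (\<integral>x. ((u x + v x) / 2)\<^sup>2 \<partial>\<mu>)"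
    using int by (simp add: Bochner_Integration.integral_diff Bochner_Integration.integral_add)
  also have "\<dots> \<le> 4 * a"
    using I[OF approximant_midpoint[OF u(1) v(1)]] u(2) v(2) by linarith
  finally have "(\<integral>x. (u x - v x)\<^sup>2 \<partial>\<mu>) \<le> 4 * a" .
  then show ?thesis
    using integral_abs_le_sqrt[OF bm_diff[OF bm]] real_sqrt_le_mono order_trans by blast
qed

text \<open>A minimizing sequence is Cauchy in L^1 and converges to \<open>v\<close>. Translates of
  near-minimizers are near-minimizers too, hence close to the originals, which forces
  \<open>v\<close> to be invariant.\<close>

lemma invariant_limit_of_approximants:
  assumes f: "bounded_measurable B f"
  shows "\<exists>w v. (\<forall>n. approximant B f (w n)) \<and> bounded_measurable B v \<and>
    (\<lambda>n. \<integral>x. \<bar>w n x - v x\<bar> \<partial>\<mu>) \<longlonglongrightarrow> 0 \<and> (\<forall>g. AE x in \<mu>. v (T g x) = v x)"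
proof -
  define I where "I = (INF v\<in>Collect (approximant B f). \<integral>x. (v x)\<^sup>2 \<partial>\<mu>)"
  have bdd: "bdd_below ((\<lambda>v. \<integral>x. (v x)\<^sup>2 \<partial>\<mu>) ` Collect (approximant B f))"
    by (rule bdd_belowI2[of _ 0]) simp
  have ne: "Collect (approximant B f) \<noteq> {}" using approximant_refl[OF f] by blast
  have I: "I \<le> (\<integral>x. (v x)\<^sup>2 \<partial>\<mu>)" if "approximant B f v" for v
    unfolding I_def by (rule cINF_lower[OF bdd]) (use that in simp)
  have "\<exists>v. approximant B f v \<and> (\<integral>x. (v x)\<^sup>2 \<partial>\<mu>) < I + 1 / Suc n" for n
  proof -
    have "I < I + 1 / Suc n" by simp
    then have "(INF v\<in>Collect (approximant B f). \<integral>x. (v x)\<^sup>2 \<partial>\<mu>) < I + 1 / Suc n"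
      unfolding I_def .
    then show ?thesis unfolding cINF_less_iff[OF ne bdd] by simp
  qed
  then have "\<exists>w. \<forall>n. approximant B f (w n) \<and> (\<integral>x. (w n x)\<^sup>2 \<partial>\<mu>) < I + 1 / Suc n"
    by (rule choice[OF allI])
  then obtain w where "\<forall>n. approximant B f (w n) \<and> (\<integral>x. (w n x)\<^sup>2 \<partial>\<mu>) < I + 1 / Suc n"
    by (rule exE)
  then have w: "approximant B f (w n)" and w_less: "(\<integral>x. (w n x)\<^sup>2 \<partial>\<mu>) < I + 1 / Suc n" for n
    by blast+
  have bm: "bounded_measurable B (w n)" for n using w[of n] unfolding approximant_def by simp
  have w_le: "(\<integral>x. (w n x)\<^sup>2 \<partial>\<mu>) \<le> I + 1 / Suc N" if "N \<le> n" for n N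
  proof -
    have "1 / real (Suc n) \<le> 1 / real (Suc N)" using that by (intro divide_left_mono) auto
    then show ?thesis using w_less[of n] by linarith
  qed
  have lim: "(\<lambda>n. sqrt (4 * (1 / Suc n))) \<longlonglongrightarrow> 0"
  proof -
    have "(\<lambda>n. sqrt (4 * (1 / Suc n))) \<longlonglongrightarrow> sqrt (4 * 0)"
      by (intro tendsto_intros LIMSEQ_Suc[OF lim_1_over_n])
    then show ?thesis by simp
  qed
  have "\<exists>N. \<forall>i\<ge>N. \<forall>j\<ge>N. (\<integral>x. norm (w i x - w j x) \<partial>\<mu>) < e" if e: "e > 0" for e
  proof -
    obtain N where N: "sqrt (4 * (1 / Suc N)) < e"
      using order_tendstoD(2)[OF lim e] by (auto simp: eventually_sequentially)
    have "(\<integral>x. norm (w i x - w j x) \<partial>\<mu>) < e" if "N \<le> i" "N \<le> j" for i j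
      using approximants_near_minimum[OF w w_le[OF that(1)] w w_le[OF that(2)] I] N by simp
    then show ?thesis by blast
  qed
  \<comment> \<open>The limit is taken pointwise along an almost everywhere Cauchy subsequence,
    which is also the sequence finally returned.\<close>
  then obtain r where r: "strict_mono r" "AE x in \<mu>. Cauchy (\<lambda>i. w (r i) x)"
    using cauchy_L1_AE_cauchy_subseq[of \<mu> w, OF integrable_bm[OF bm]] by metis
  \<comment> \<open>The value 0 off the convergence set keeps \<open>v\<close> measurable and
    bounded by \<open>B\<close> at every point.\<close>
  define v where "v x = (if Cauchy (\<lambda>i. w (r i) x) then lim (\<lambda>i. w (r i) x) else 0)" for x
  have w_borel [measurable]: "w n \<in> borel_measurable borel" for n by (rule bm_borel[OF bm])
  have B: "0 \<le> B" using bm_le[OF f] abs_ge_zero order_trans by blast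
  have bmv: "bounded_measurable B v"
    unfolding bounded_measurable_def
  proof (intro conjI allI)
    show "v \<in> borel_measurable borel" unfolding v_def[abs_def] by measurable
    show "\<bar>v x\<bar> \<le> B" for x
    proof (cases "Cauchy (\<lambda>i. w (r i) x)")
      case True
      then have "(\<lambda>i. w (r i) x) \<longlonglongrightarrow> v x" by (simp add: v_def Cauchy_convergent_iff convergent_LIMSEQ_iff)
      then have "(\<lambda>i. \<bar>w (r i) x\<bar>) \<longlonglongrightarrow> \<bar>v x\<bar>" by (rule tendsto_rabs)
      then show ?thesis by (rule LIMSEQ_le_const2) (use bm_le[OF bm] in blast)
    qed (simp add: v_def B)
  qed
  have v_lim: "AE x in \<mu>. (\<lambda>i. w (r i) x) \<longlonglongrightarrow> v x"
    using r(2) by eventually_elim (simp add: v_def Cauchy_convergent_iff convergent_LIMSEQ_iff)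
  have L1: "(\<lambda>i. \<integral>x. \<bar>w (r i) x - v x\<bar> \<partial>\<mu>) \<longlonglongrightarrow> 0"
  proof -
    note [measurable] = bm_borel[OF bmv]
    have "(\<lambda>i. \<integral>x. \<bar>w (r i) x - v x\<bar> \<partial>\<mu>) \<longlonglongrightarrow> (\<integral>x. 0 \<partial>\<mu>)"
    proof (rule integral_dominated_convergence[where w="\<lambda>_. B + B"])
      show "AE x in \<mu>. (\<lambda>i. \<bar>w (r i) x - v x\<bar>) \<longlonglongrightarrow> 0"
        using v_lim by eventually_elim (auto intro!: tendsto_rabs_zero simp: LIM_zero)
      show "AE x in \<mu>. norm \<bar>w (r i) x - v x\<bar> \<le> B + B" for i
        using bm_le[OF bm_diff[OF bm bmv]] by auto
    qed auto
    then show ?thesis by simp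
  qed
  have inv: "AE x in \<mu>. v (T g x) = v x" for g
  proof -
    note [measurable] = bm_borel[OF bmv]
    \<comment> \<open>Triangle inequality through \<open>w (r i)\<close> and its translate: the
      outer two differences have equal integrals by invariance of \<mu>, and the middle one compares
      two near-minimizers.\<close>
    have "(\<integral>x. \<bar>v (T g x) - v x\<bar> \<partial>\<mu>)
        \<le> 2 * (\<integral>x. \<bar>w (r i) x - v x\<bar> \<partial>\<mu>) + sqrt (4 * (1 / Suc (r i)))" for i
    proof -
      let ?w = "w (r i)"
      note bmw = bm[of "r i"]
      have int: "integrable \<mu> (\<lambda>x. \<bar>?w x - v x\<bar>)" "integrable \<mu> (\<lambda>x. \<bar>?w (T g x) - v (T g x)\<bar>)"
          "integrable \<mu> (\<lambda>x. \<bar>?w (T g x) - ?w x\<bar>)" "integrable \<mu> (\<lambda>x. \<bar>v (T g x) - v x\<bar>)"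
        by (rule integrable_bm[OF bm_abs[OF bm_diff]] bm_T bmw bmv)+
      have "(\<integral>x. \<bar>v (T g x) - v x\<bar> \<partial>\<mu>)
          \<le> (\<integral>x. \<bar>?w x - v x\<bar> + \<bar>?w (T g x) - v (T g x)\<bar> + \<bar>?w (T g x) - ?w x\<bar> \<partial>\<mu>)"
        using int by (intro integral_mono) auto
      also have "\<dots> = (\<integral>x. \<bar>?w x - v x\<bar> \<partial>\<mu>) + (\<integral>x. \<bar>?w (T g x) - v (T g x)\<bar> \<partial>\<mu>)
          + (\<integral>x. \<bar>?w (T g x) - ?w x\<bar> \<partial>\<mu>)"
        using int by simp
      also have "(\<integral>x. \<bar>?w (T g x) - v (T g x)\<bar> \<partial>\<mu>) = (\<integral>x. \<bar>?w x - v x\<bar> \<partial>\<mu>)"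
        by (rule integral_T[of "\<lambda>x. \<bar>?w x - v x\<bar>"]) measurable
      also have "(\<integral>x. \<bar>?w (T g x) - ?w x\<bar> \<partial>\<mu>) \<le> sqrt (4 * (1 / Suc (r i)))"
      proof (rule approximants_near_minimum[OF approximant_T[OF w] _ w w_le[OF order_refl] I])
        have "(\<integral>x. (?w (T g x))\<^sup>2 \<partial>\<mu>) = (\<integral>x. (?w x)\<^sup>2 \<partial>\<mu>)"
          by (rule integral_T[of "\<lambda>x. (?w x)\<^sup>2"]) measurable
        then show "(\<integral>x. (?w (T g x))\<^sup>2 \<partial>\<mu>) \<le> I + 1 / Suc (r i)"
          using w_le[OF order_refl, of "r i"] by simp
      qed
      finally show ?thesis by simp
    qed
    moreover have "(\<lambda>i. 2 * (\<integral>x. \<bar>w (r i) x - v x\<bar> \<partial>\<mu>) + sqrt (4 * (1 / Suc (r i)))) \<longlonglongrightarrow> 2 * 0 + 0"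
      by (intro tendsto_add tendsto_mult tendsto_const L1)
        (use LIMSEQ_subseq_LIMSEQ[OF lim r(1)] in \<open>simp add: o_def\<close>)
    ultimately have "(\<integral>x. \<bar>v (T g x) - v x\<bar> \<partial>\<mu>) \<le> 2 * 0 + 0"
      by (intro LIMSEQ_le_const) auto
    moreover have "0 \<le> (\<integral>x. \<bar>v (T g x) - v x\<bar> \<partial>\<mu>)" by simp
    ultimately have "(\<integral>x. \<bar>v (T g x) - v x\<bar> \<partial>\<mu>) = 0" by linarith
    moreover have "integrable \<mu> (\<lambda>x. \<bar>v (T g x) - v x\<bar>)"
      by (rule integrable_bm[OF bm_abs[OF bm_diff[OF bm_T[OF bmv] bmv]]])
    ultimately have "AE x in \<mu>. \<bar>v (T g x) - v x\<bar> = 0"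
      by (subst (asm) integral_nonneg_eq_0_iff_AE) auto
    then show ?thesis by eventually_elim simp
  qed
  show ?thesis
    by (intro exI[of _ "\<lambda>i. w (r i)"] exI[of _ v] conjI allI w bmv L1 inv)
qed

section \<open>From mean to pointwise convergence\<close>

lemma real_cond_exp_invariant_algebra:
  assumes f: "bounded_measurable B f" and w: "\<And>n. approximant B f (w n)"
    and v: "bounded_measurable B v" "(\<lambda>n. \<integral>x. \<bar>w n x - v x\<bar> \<partial>\<mu>) \<longlonglongrightarrow> 0"
      "\<And>g. AE x in \<mu>. v (T g x) = v x"
  shows "AE x in \<mu>. real_cond_exp \<mu> (invariant_algebra T \<mu>) f x = v x"
proof -
  interpret S: finite_measure_subalgebra \<mu> "invariant_algebra T \<mu>"
    by unfold_locales (rule subalgebra_invariant_algebra[OF preserves])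
  show ?thesis
  \<comment> \<open>Approximants have the same integrals as \<open>f\<close> over invariant sets,
    and L^1-convergence passes this on to \<open>v\<close>; together with invariance this
    characterizes the conditional expectation.\<close>
  proof (rule S.real_cond_exp_charact)
    fix A assume "A \<in> sets (invariant_algebra T \<mu>)"
    then have inv: "A \<in> invariant_sets T \<mu>" by (simp add: sets_invariant_algebra[OF preserves])
    then have A: "A \<in> sets \<mu>" unfolding invariant_sets_def by auto
    have "\<bar>(LINT x:A|\<mu>. f x) - (LINT x:A|\<mu>. v x)\<bar> \<le> (\<integral>x. \<bar>w n x - v x\<bar> \<partial>\<mu>)" for n
    proof -
      have bmw: "bounded_measurable B (w n)" using w[of n] unfolding approximant_def by simp
      note bmd = bm_diff[OF bmw v(1)]
      have "(LINT x:A|\<mu>. f x) - (LINT x:A|\<mu>. v x) = (LINT x:A|\<mu>. w n x - v x)"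
        using set_integral_diff(2)[OF set_integrable_bm[OF bmw A] set_integrable_bm[OF v(1) A]]
          w[of n] inv unfolding approximant_def by simp
      also have "\<bar>\<dots>\<bar> \<le> (LINT x:A|\<mu>. \<bar>w n x - v x\<bar>)"
        using set_integral_norm_bound[OF set_integrable_bm[OF bmd A]] by simp
      also have "\<dots> \<le> (\<integral>x. \<bar>w n x - v x\<bar> \<partial>\<mu>)"
        unfolding set_lebesgue_integral_def
        using set_integrable_bm[OF bm_abs[OF bmd] A] integrable_bm[OF bm_abs[OF bmd]]
        by (intro integral_mono) (auto simp: set_integrable_def indicator_def)
      finally show ?thesis .
    qed
    then have "\<bar>(LINT x:A|\<mu>. f x) - (LINT x:A|\<mu>. v x)\<bar> \<le> 0"
      by (intro LIMSEQ_le_const[OF v(2)]) auto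
    then show "(LINT x:A|\<mu>. f x) = (LINT x:A|\<mu>. v x)" by simp
  next
    show "v \<in> borel_measurable (invariant_algebra T \<mu>)"
      unfolding measurable_invariant_algebra_iff[OF preserves]
      using bm_borel[OF v(1)] v(3) by (simp add: measurable_cong_sets[OF sets_\<mu> refl])
  qed (rule integrable_bm[OF f] integrable_bm[OF v(1)])+
qed

text \<open>At every point the averages of \<open>f\<close> follow those of \<open>w n\<close>,
  while those of \<open>v\<close> are constant almost everywhere. What remains are the averages of
  \<open>\<bar>w n x - v x\<bar>\<close>, controlled for all \<open>k\<close> at once by the maximal
  inequality.\<close>

theorem pointwise_ergodic_theorem:
  assumes f: "bounded_measurable B f"
  shows "AE x in \<mu>. (\<lambda>k. avg k f x) \<longlonglongrightarrow> real_cond_exp \<mu> (invariant_algebra T \<mu>) f x"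
proof -
  obtain w v where "(\<forall>n. approximant B f (w n)) \<and> bounded_measurable B v \<and>
      (\<lambda>n. \<integral>x. \<bar>w n x - v x\<bar> \<partial>\<mu>) \<longlonglongrightarrow> 0 \<and> (\<forall>g. AE x in \<mu>. v (T g x) = v x)"
    using invariant_limit_of_approximants[OF f] by (elim exE)
  then have w: "approximant B f (w n)" and v: "bounded_measurable B v"
    and L1: "(\<lambda>n. \<integral>x. \<bar>w n x - v x\<bar> \<partial>\<mu>) \<longlonglongrightarrow> 0" and inv: "AE x in \<mu>. v (T g x) = v x" for n g
    by blast+
  have bmw: "bounded_measurable B (w n)" for n using w[of n] unfolding approximant_def by simp
  let ?r = "\<lambda>n x. \<bar>w n x - v x\<bar>"
  have bmr: "bounded_measurable (B + B) (?r n)" for n by (rule bm_abs[OF bm_diff[OF bmw v]])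
  \<comment> \<open>The failing points lie in every \<open>N n\<close>, and the measure of
    \<open>N n\<close> is at most a constant over \<theta> times an L^1-norm that tends to
    0.\<close>
  have "AE x in \<mu>. \<exists>n. \<forall>k. avg k (?r n) x \<le> \<theta>" if \<theta>: "\<theta> > 0" for \<theta> :: real
  proof -
    define N where "N n = {x. \<exists>k. \<theta> < avg k (?r n) x}" for n
    have N: "N n \<in> sets \<mu>" for n
    proof -
      note [measurable] = measurable_avg[OF bmr]
      have "{x \<in> space borel. \<exists>k. \<theta> < avg k (?r n) x} \<in> sets borel" by measurable
      then show ?thesis by (simp add: N_def sets_\<mu>)
    qed
    have "ennreal \<theta> * emeasure \<mu> (\<Inter>n. N n) \<le> (1 + c) * (2 * ennreal (\<integral>x. ?r n x \<partial>\<mu>))" for n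
    proof -
      have "ennreal \<theta> * emeasure \<mu> (\<Inter>n. N n) \<le> ennreal \<theta> * emeasure \<mu> (N n)"
        using N by (intro mult_left_mono emeasure_mono) auto
      also have "\<dots> \<le> (1 + c) * (2 * (\<integral>\<^sup>+x. ?r n x \<partial>\<mu>))"
        unfolding N_def by (rule maximal_inequality[OF bmr]) (use \<theta> in auto)
      also have "(\<integral>\<^sup>+x. ?r n x \<partial>\<mu>) = ennreal (\<integral>x. ?r n x \<partial>\<mu>)"
        by (rule nn_integral_eq_integral[OF integrable_bm[OF bmr]]) simp
      finally show ?thesis .
    qed
    \<comment> \<open>Finiteness of \<open>c\<close> allows the constant to be taken out of the
      limit of extended reals.\<close>
    moreover have "(\<lambda>n. (1 + c) * (2 * ennreal (\<integral>x. ?r n x \<partial>\<mu>))) \<longlonglongrightarrow> (1 + c) * (2 * ennreal 0)"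
      using c_finite by (intro ennreal_tendsto_cmult tendsto_ennrealI L1) auto
    ultimately have "ennreal \<theta> * emeasure \<mu> (\<Inter>n. N n) \<le> (1 + c) * (2 * ennreal 0)"
      by (intro LIMSEQ_le_const) auto
    then have "emeasure \<mu> (\<Inter>n. N n) = 0" using \<theta> by simp
    moreover have "(\<Inter>n. N n) \<in> sets \<mu>" using N by auto
    ultimately have "AE x in \<mu>. x \<notin> (\<Inter>n. N n)" by (intro AE_not_in) (auto simp: null_sets_def)
    then show ?thesis by eventually_elim (auto simp: N_def not_less)
  qed
  \<comment> \<open>Countably many thresholds suffice and leave a single null set.\<close>
  then have "AE x in \<mu>. \<forall>i::nat. \<exists>n. \<forall>k. avg k (?r n) x \<le> 1 / Suc i"
    unfolding AE_all_countable by simp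
  moreover have "AE x in \<mu>. \<forall>k. avg k v x = v x" by (rule avg_invariant[OF v inv])
  moreover have "AE x in \<mu>. real_cond_exp \<mu> (invariant_algebra T \<mu>) f x = v x"
    by (rule real_cond_exp_invariant_algebra[OF f w v L1 inv])
  ultimately show ?thesis
  proof eventually_elim
    case (elim x)
    have "\<exists>K. \<forall>k\<ge>K. norm (avg k f x - v x) < e" if e: "e > 0" for e
    proof -
      obtain i :: nat where i: "1 / Suc i < e / 2"
        using reals_Archimedean[of "e/2"] e by (auto simp: inverse_eq_divide)
      obtain n where n: "\<And>k. avg k (?r n) x \<le> 1 / Suc i" using elim(1) by blast
      have "\<bar>avg k (w n) x - v x\<bar> < e / 2" for k
      proof -
        have "avg k (w n) x - v x = avg k (\<lambda>x. w n x - v x) x"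
          using avg_diff[OF bmw v] elim(2) by simp
        then show ?thesis
          using avg_abs[OF bm_diff[OF bmw v], of k n x] n[of k] i by linarith
      qed
      moreover obtain K where "\<And>k. k \<ge> K \<Longrightarrow> \<bar>avg k f x - avg k (w n) x\<bar> < e / 2"
      proof -
        have "(\<lambda>k. avg k f x - avg k (w n) x) \<longlonglongrightarrow> 0" using w[of n] unfolding approximant_def by blast
        then have "\<exists>K. \<forall>k\<ge>K. norm (avg k f x - avg k (w n) x - 0) < e / 2"
          using e unfolding LIMSEQ_iff by (meson half_gt_zero)
        then show thesis using that by auto
      qed
      ultimately have "norm (avg k f x - v x) < e" if "k \<ge> K" for k
        using that by (smt (verit) field_sum_of_halves real_norm_def)
      then show ?thesis by blast
    qed
    then have "(\<lambda>k. avg k f x) \<longlonglongrightarrow> v x" unfolding LIMSEQ_iff by blast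
    then show ?case using elim(3) by simp
  qed
qed

end

section \<open>Averages over shrinking sets\<close>

text \<open>Compactness bounds \<open>p\<close>, so the supremum defining \<open>pdiam\<close> is
  that of a set bounded above.\<close>

lemma pdiam_upper:
  fixes p :: "'x::topological_space \<Rightarrow> 'x \<Rightarrow> real"
  assumes "pseudometric p" "induces_topology p" "compact (UNIV :: 'x set)" "x \<in> C" "y \<in> C"
  shows "p x y \<le> pdiam p C"
proof -
  obtain b where "\<forall>x y. p x y \<le> b" using pseudometric_bdd[OF assms(1-3)] by (rule exE)
  then have "bdd_above ((\<lambda>(x, y). p x y) ` (C \<times> C))" by (intro bdd_aboveI2[of _ _ b]) auto
  then show ?thesis
    unfolding pdiam_def using cSUP_upper[of "(x, y)" "C \<times> C" "\<lambda>(x, y). p x y"] assms(4,5) by simp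
qed

text \<open>Serves twice: with \<open>z\<close> the value at \<open>x\<close>, to compare an average
  over \<open>C\<close> with that value, and with \<open>z = 0\<close>, to bound an average.\<close>

lemma set_average_close:
  fixes h :: "'a \<Rightarrow> 'b::{banach, second_countable_topology}"
  assumes h: "set_integrable M C h" and C: "measure M C > 0"
    and e: "\<And>y. y \<in> C \<Longrightarrow> norm (h y - z) \<le> e"
  shows "norm ((1 / measure M C) *\<^sub>R (LINT y:C|M. h y) - z) \<le> e"
proof -
  \<comment> \<open>\<open>measure\<close> is 0 for nonmeasurable sets and for sets of infinite
    measure, so positivity excludes both.\<close>
  have Cs: "C \<in> sets M" "emeasure M C \<noteq> \<infinity>" using C measure_notin_sets[of C M] by (force, auto simp: measure_def)
  have const: "set_integrable M C (\<lambda>_. a)" for a :: "'c::{banach, second_countable_topology}"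
    unfolding set_integrable_def using Cs by (intro integrableI_bounded_set_indicator[where B="norm a"]) (auto simp: top.not_eq_extremum)
  have d: "set_integrable M C (\<lambda>y. h y - z)" by (rule set_integral_diff(1)[OF h const])
  have "(LINT y:C|M. h y - z) = (LINT y:C|M. h y) - measure M C *\<^sub>R z"
    using set_integral_diff(2)[OF h const[of z]] set_integral_const[OF Cs, of z] by simp
  then have "(1 / measure M C) *\<^sub>R (LINT y:C|M. h y) - z = (1 / measure M C) *\<^sub>R (LINT y:C|M. h y - z)"
    using C by (simp add: scaleR_diff_right)
  also have "norm \<dots> = (1 / measure M C) * norm (LINT y:C|M. h y - z)" by simp
  also have "\<dots> \<le> (1 / measure M C) * (LINT y:C|M. e)"
    using set_integral_norm_bound[OF d] set_integral_mono[OF set_integrable_norm[OF d] const[of e]] e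
    by (intro mult_left_mono) (auto intro: order_trans)
  also have "\<dots> = e" using set_integral_const[OF Cs, of e] C by simp
  finally show ?thesis .
qed

section \<open>Comparison of orbit averages at nearby points\<close>

context pmp_action
begin

text \<open>For \<open>g\<close> outside the exceptional set the images of \<open>x\<close> and
  \<open>y\<close> are within \<delta>, so \<open>f\<close> varies by at most \<open>e\<close>; on
  the exceptional set the difference is at most \<open>2 * B\<close>. The bound depends on
  \<open>y\<close> only through \<open>d\<close>.\<close>

lemma Avg_equicontinuity:
  fixes p :: "'x \<Rightarrow> 'x \<Rightarrow> real" and H L :: "'g \<Rightarrow> real"
  assumes K: "K \<in> sets m" "emeasure m K < \<infinity>" "measure m K > 0"
    and [measurable]: "H \<in> borel_measurable borel" "L \<in> borel_measurable borel"
    and "\<And>g. H g > 0" "\<And>g. L g > 0"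
    and lip: "\<And>g x y. p (T g x) (T g y) \<le> L g * p x y powr H g"
    and p: "\<And>x y. 0 \<le> p x y" and d: "p x y \<le> d"
    and f [measurable]: "f \<in> borel_measurable borel" and B: "\<And>x. norm (f x) \<le> B"
    and e: "0 \<le> e" "\<And>x y. p x y \<le> \<delta> \<Longrightarrow> norm (f x - f y) \<le> e"
  shows "norm (Avg m T K f y - Avg m T K f x)
    \<le> e + 2 * B * (measure m {g \<in> K. L g * d powr H g > \<delta>} / measure m K)"
proof -
  let ?S = "{g \<in> K. L g * d powr H g > \<delta>}"
  have [measurable]: "K \<in> sets borel" using K(1) by (simp add: sets_m)
  have "K \<inter> {g \<in> space borel. L g * d powr H g > \<delta>} \<in> sets borel" by measurable
  moreover have "K \<inter> {g \<in> space borel. L g * d powr H g > \<delta>} = ?S" by auto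
  ultimately have S: "?S \<in> sets m" by (simp add: sets_m)
  have B0: "0 \<le> B" using B norm_ge_zero order_trans by blast
  have int: "set_integrable m K h" if "h \<in> borel_measurable m" "\<And>g. norm (h g) \<le> b"
    for h :: "'g \<Rightarrow> 'c::{banach, second_countable_topology}" and b
    unfolding set_integrable_def by (rule integrableI_bounded_set_indicator[where B=b]) (use K that in auto)
  have f_int: "set_integrable m K (\<lambda>g. f (T g z))" for z
    by (rule int[of _ B]) (use B in auto)
  have d_int: "set_integrable m K (\<lambda>g. f (T g y) - f (T g x))"
    by (rule set_integral_diff(1)[OF f_int f_int])
  have S_int: "set_integrable m K (\<lambda>g. e + 2 * B * indicator ?S g)"
    by (rule int[of _ "e + 2 * B"]) (use S e B0 in \<open>auto simp: indicator_def\<close>)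
  have bound: "norm (f (T g y) - f (T g x)) \<le> e + 2 * B * indicator ?S g" if g: "g \<in> K" for g
  proof (cases "g \<in> ?S")
    case True
    then show ?thesis
      using norm_triangle_ineq4[of "f (T g y)" "f (T g x)"] B[of "T g y"] B[of "T g x"] e(1) by simp
  next
    case False
    \<comment> \<open>Monotonicity of the power in its base uses \<open>H g > 0\<close>.\<close>
    have "p x y powr H g \<le> d powr H g"
      using p d assms(6)[of g] by (intro powr_mono2) (auto simp: less_imp_le)
    then have "L g * p x y powr H g \<le> L g * d powr H g"
      using assms(7)[of g] by (intro mult_left_mono) auto
    then have "p (T g x) (T g y) \<le> \<delta>" using lip[of g x y] False g by auto
    then show ?thesis using e(2)[of "T g x" "T g y"] False by (simp add: norm_minus_commute)
  qed
  have val: "(LINT g:K|m. e + 2 * B * indicator ?S g) = measure m K * e + 2 * B * measure m ?S"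
  proof -
    have "(LINT g:K|m. e + 2 * B * indicator ?S g) = (LINT g:K|m. e) + (LINT g:K|m. 2 * B * indicator ?S g)"
      by (rule set_integral_add(2)) (rule int[of _ e], use e in simp, use e in simp,
        rule int[of _ "2 * B"], use S in simp, use B0 in \<open>simp add: indicator_def\<close>)
    also have "(LINT g:K|m. e) = measure m K * e"
      using set_integral_const[of K m e] K by auto
    also have "(LINT g:K|m. 2 * B * indicator ?S g) = (\<integral>g. 2 * B * indicator ?S g \<partial>m)"
      unfolding set_lebesgue_integral_def by (intro Bochner_Integration.integral_cong) (auto simp: indicator_def)
    also have "\<dots> = 2 * B * measure m ?S" using S by simp
    finally show ?thesis .
  qed
  have "Avg m T K f y - Avg m T K f x = (1 / measure m K) *\<^sub>R (LINT g:K|m. f (T g y) - f (T g x))"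
    unfolding Avg_def using set_integral_diff(2)[OF f_int f_int] by (simp add: scaleR_diff_right)
  also have "norm \<dots> = (1 / measure m K) * norm (LINT g:K|m. f (T g y) - f (T g x))" by simp
  also have "\<dots> \<le> (1 / measure m K) * (LINT g:K|m. e + 2 * B * indicator ?S g)"
    using set_integral_norm_bound[OF d_int] set_integral_mono[OF set_integrable_norm[OF d_int] S_int bound]
    by (intro mult_left_mono) (auto intro: order_trans)
  also have "\<dots> = e + 2 * B * (measure m ?S / measure m K)"
    unfolding val using K(3) by (simp add: field_simps)
  finally show ?thesis .
qed

end

text \<open>Integration commutes with real and imaginary parts, to which the real theorem applies
  separately.\<close>

lemma (in folner_action) Avg_tendsto_invariant_expectation:
  assumes f: "f \<in> borel_measurable borel" "\<And>x. norm (f x) \<le> B"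
  shows "AE x in \<mu>. (\<lambda>k. Avg m T (F k) f x) \<longlonglongrightarrow> invariant_expectation T \<mu> f x"
proof -
  note [measurable] = f(1)
  have Re: "bounded_measurable B (\<lambda>x. Re (f x))" and Im: "bounded_measurable B (\<lambda>x. Im (f x))"
    unfolding bounded_measurable_def
    using order_trans[OF abs_Re_le_cmod f(2)] order_trans[OF abs_Im_le_cmod f(2)] by auto
  have f_int: "integrable m (\<lambda>g. indicator (F k) g *\<^sub>R f (T g x))" for k x
    by (rule integrableI_bounded_set_indicator[where B=B]) (use F_finite[of k] f(2) in auto)
  have Avg_eq: "Avg m T (F k) f x = Complex (avg k (\<lambda>x. Re (f x)) x) (avg k (\<lambda>x. Im (f x)) x)" for k x
    using integral_Re[OF f_int[of k x]] integral_Im[OF f_int[of k x]]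
    unfolding Avg_def avg_def set_lebesgue_integral_def by (intro complex_eqI) simp_all
  show ?thesis
    using pointwise_ergodic_theorem[OF Re] pointwise_ergodic_theorem[OF Im]
    by eventually_elim (auto simp: Avg_eq invariant_expectation_def intro!: tendsto_Complex)
qed

theorem corollary3p10:
  fixes m :: "'g::topological_group_add measure"
    and p :: "'x::topological_space \<Rightarrow> 'x \<Rightarrow> real"
    and T :: "'g \<Rightarrow> 'x \<Rightarrow> 'x"
    and \<mu> :: "'x measure"
    and F :: "nat \<Rightarrow> 'g set"
    and H L :: "'g \<Rightarrow> real"
    and C :: "'x \<Rightarrow> nat \<Rightarrow> 'x set"
    and f :: "'x \<Rightarrow> complex"
  assumes "locally compact (UNIV :: 'g set)"
    and "unimodular_group TYPE('g)"
    and "amenable_group TYPE('g)"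
    and "left_haar_measure m"
    and "pseudometric p" and "induces_topology p" and "compact (UNIV :: 'x set)"
    and "continuous_action T"
    and "prob_space \<mu>" and "regular_borel_measure \<mu>"
    and "preserves_measure T \<mu>"
    and "folner_sequence m F" and "tempered_sequence m F"
    and "H \<in> borel_measurable borel" and "L \<in> borel_measurable borel"
    and "\<And>g. H g > 0" and "\<And>g. L g > 0"
    and "\<And>g x y. p (T g x) (T g y) \<le> L g * p x y powr H g"
    and "\<And>x k. C x k \<in> sets \<mu>" and "\<And>x k. x \<in> C x k" and "\<And>x k. measure \<mu> (C x k) > 0"
    and "AE x in \<mu>. \<forall>\<delta>>0.
           (\<lambda>k. measure m {g \<in> F k. L g * pdiam p (C x k) powr H g > \<delta>} / measure m (F k))
             \<longlonglongrightarrow> 0"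
    and "continuous_on UNIV f"
  shows "AE x in \<mu>.
           (\<lambda>k. alpha \<mu> (C x k) (Avg m T (F k) f)) \<longlonglongrightarrow> invariant_expectation T \<mu> f x"
proof -
  have haar: "sets m = sets borel" "\<And>K. compact K \<Longrightarrow> emeasure m K < \<infinity>" "left_invariant_measure m"
    using assms(4) unfolding left_haar_measure_def by auto
  interpret pmp_action m T \<mu>
  proof (rule pmp_action.intro)
    show "(\<lambda>(g, x). T g x) \<in> borel \<Otimes>\<^sub>M borel \<rightarrow>\<^sub>M borel"
      by (rule measurable_continuous_action[OF assms(5-8)])
    show "sets \<mu> = sets borel" using assms(10) unfolding regular_borel_measure_def by (rule conjunct1)
    show "T 0 x = x" and "T (g + h) x = T g (T h x)" for g h x
      using assms(8) unfolding continuous_action_def by blast+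
  qed (fact haar(1) haar(3) assms(9) assms(11))+
  have F: "compact (F k)" "measure m (F k) > 0" for k
    using assms(12) unfolding folner_sequence_def by auto
  \<comment> \<open>A set outside the sigma-algebra would have \<open>measure\<close> 0.\<close>
  have F_sets: "F k \<in> sets m" for k using F(2)[of k] measure_notin_sets[of "F k" m] by force
  have F_pos: "0 < emeasure m (F k)" for k
    using F(2)[of k] by (auto simp: measure_def zero_less_iff_neq_zero)
  let ?P = "\<lambda>j i. {- a + b | a b. a \<in> F j \<and> b \<in> F i}"
  \<comment> \<open>The product sets are closed even if the group is not Hausdorff, hence
    Borel.\<close>
  have P_sets: "?P j i \<in> sets m" for j i
    unfolding haar(1) by (rule borel_closed[OF closed_minus_plus[OF F(1) F(1) F_sets[unfolded haar(1)]]])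
  have P_fin: "emeasure m (?P j i) < \<infinity>" for j i
    by (intro haar(2) compact_minus_plus F)
  obtain c where "c > 0 \<and> (\<forall>k. measure m (\<Union>j<k. ?P j k) \<le> c * measure m (F k))"
    using assms(13) unfolding tempered_sequence_def by (rule exE)
  then have c: "c > 0" "measure m (\<Union>j<k. ?P j k) \<le> c * measure m (F k)" for k by auto
  interpret folner_action m T \<mu> F ?P "ennreal c"
  proof
    fix k a
    show "emeasure m (\<Union>j<k. ?P j k) \<le> ennreal c * emeasure m (F k)"
    proof -
      \<comment> \<open>The tempered bound is stated with \<open>measure\<close>, which is 0 on sets
        of infinite measure; compactness of the finite union rules this out before passing to
        \<open>emeasure\<close>.\<close>
      have "emeasure m (\<Union>j<k. ?P j k) < \<infinity>"
        by (intro haar(2) compact_UN compact_minus_plus F) auto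
      then have "emeasure m (\<Union>j<k. ?P j k) = ennreal (measure m (\<Union>j<k. ?P j k))"
        by (intro emeasure_eq_ennreal_measure) auto
      also have "\<dots> \<le> ennreal (c * measure m (F k))" by (intro ennreal_leI c(2))
      also have "\<dots> = ennreal c * emeasure m (F k)"
        using c(1) haar(2)[OF F(1), of k] by (simp add: ennreal_mult emeasure_eq_ennreal_measure)
      finally show ?thesis .
    qed
    show "(\<lambda>k. measure m (sym_diff ((+) a ` F k) (F k)) / measure m (F k)) \<longlonglongrightarrow> 0"
      using assms(12) unfolding folner_sequence_def by blast
  qed (rule F_sets F_pos P_sets P_fin haar(2)[OF F(1)] refl | simp)+
  have f_borel [measurable]: "f \<in> borel_measurable borel"
    by (rule borel_measurable_continuous_onI[OF assms(23)])
  have "\<exists>B. \<forall>x. norm (f x) \<le> B"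
    using compact_imp_bounded[OF compact_continuous_image[OF assms(23,7)]] unfolding bounded_iff by blast
  then obtain B where B: "\<And>x. norm (f x) \<le> B" by (elim exE) (rule that, blast)
  have Avg_borel: "Avg m T (F k) f \<in> borel_measurable \<mu>" for k
  proof -
    have "(\<lambda>x. LINT g:F k|m. f (T g x)) \<in> borel_measurable borel"
      by (rule measurable_set_integral_on[OF F_sets haar(2)[OF F(1)]]) measurable
    then show ?thesis unfolding Avg_def[abs_def] measurable_cong_sets[OF sets_\<mu> refl] by measurable
  qed
  have Avg_int: "integrable \<mu> (Avg m T (F k) f)" for k
  proof (rule integrable_const_bound[where B=B])
    \<comment> \<open>Closeness of the average to 0 is the bound that makes it integrable over the
      sets \<open>C x k\<close>.\<close>
    have "norm (Avg m T (F k) f x - 0) \<le> B" for x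
      unfolding Avg_def
    proof (rule set_average_close)
      show "set_integrable m (F k) (\<lambda>g. f (T g x))"
        unfolding set_integrable_def
        by (rule integrableI_bounded_set_indicator[where B=B]) (use F_sets haar(2)[OF F(1)] B in auto)
    qed (use F(2) B in auto)
    then show "AE x in \<mu>. norm (Avg m T (F k) f x) \<le> B" by simp
  qed (rule Avg_borel)
  show ?thesis
    using Avg_tendsto_invariant_expectation[OF f_borel B] assms(22)
  proof eventually_elim
    case (elim x)
    have "(\<lambda>k. alpha \<mu> (C x k) (Avg m T (F k) f) - Avg m T (F k) f x) \<longlonglongrightarrow> 0"
    proof (rule LIMSEQ_I)
      fix r :: real assume r: "0 < r"
      obtain d where d: "d > 0" "\<And>x y. p x y < d \<Longrightarrow> dist (f x) (f y) < r / 2"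
        using uniformly_continuous_pseudometric[OF assms(5-7,23), of "r / 2"] r by (meson half_gt_zero)
      \<comment> \<open>Uniform continuity holds for distances strictly below \<open>d\<close>,
        whereas the equicontinuity estimate requires a bound for distances up to its threshold;
        \<open>d / 2\<close> reconciles the two.\<close>
      let ?q = "\<lambda>k. measure m {g \<in> F k. L g * pdiam p (C x k) powr H g > d / 2} / measure m (F k)"
      have "?q \<longlonglongrightarrow> 0" by (rule elim(2)[rule_format, OF half_gt_zero[OF d(1)]])
      then have "(\<lambda>k. r / 2 + 2 * B * ?q k) \<longlonglongrightarrow> r / 2 + 2 * B * 0"
        by (intro tendsto_intros)
      then have "\<forall>\<^sub>F k in sequentially. r / 2 + 2 * B * ?q k < r"
        by (rule order_tendstoD(2)) (use r in simp)
      then obtain N where N: "\<And>k. k \<ge> N \<Longrightarrow> r / 2 + 2 * B * ?q k < r"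
        unfolding eventually_sequentially by blast
      \<comment> \<open>The estimate is uniform over \<open>y \<in> C x k\<close>, so it survives
        averaging over \<open>C x k\<close>.\<close>
      have "norm (alpha \<mu> (C x k) (Avg m T (F k) f) - Avg m T (F k) f x) \<le> r / 2 + 2 * B * ?q k" for k
        unfolding alpha_def
      proof (rule set_average_close)
        show "set_integrable \<mu> (C x k) (Avg m T (F k) f)"
          unfolding set_integrable_def by (intro integrable_mult_indicator Avg_int assms(19))
        fix y assume y: "y \<in> C x k"
        show "norm (Avg m T (F k) f y - Avg m T (F k) f x) \<le> r / 2 + 2 * B * ?q k"
        proof (rule Avg_equicontinuity[where p=p])
          show "p x y \<le> pdiam p (C x k)" by (rule pdiam_upper[OF assms(5-7,20) y])
          show "norm (f x - f y) \<le> r / 2" if "p x y \<le> d / 2" for x y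
            using d(2)[of x y] that d(1) by (simp add: dist_norm)
        qed (use F_sets haar(2)[OF F(1)] F(2) assms(14-18) pm_nonneg[OF assms(5)] B r in auto)
      qed (rule assms(21))
      then show "\<exists>N. \<forall>k\<ge>N. norm (alpha \<mu> (C x k) (Avg m T (F k) f) - Avg m T (F k) f x - 0) < r"
        using N by (intro exI[of _ N]) (auto intro: le_less_trans)
    qed
    from tendsto_add[OF this elim(1)] show ?case by simp
  qed
qed

end
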